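(* Let $\mathbf{\Psi}=\{\Psi_t\}_{t\ge0}$ be a dynamical quantum system with respect to the Hilbert space $\mathcal{H}$. (a) We have $\mathcal{C}^{\mathbf{\Psi}}_2=\mathcal{C}^{\mathbf{\Psi}}_{\mathrm{p}}=\mathcal{C}^{\mathbf{\Psi}}_{\mathrm{c}}=\mathcal{C}^{\mathbf{\Psi}}_{\mathrm{w}}$ and this set is a von Neumann algebra. (b) The following assertions are equivalent: (i) $\mathcal{C}^{\mathbf{\Psi}}$ is stable under multiplication. (ii) $\mathcal{C}^{\mathbf{\Psi}}=\mathcal{C}^{\mathbf{\Psi}}_2$. (iii) $\mathcal{C}^{\mathbf{\Psi}}$ is a $C^*$-algebra. (iv) $\mathcal{C}^{\mathbf{\Psi}}$ is a von Neumann algebra.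
   Context: $\mathcal{B}(\mathcal{H})$ is the algebra of bounded operators on $\mathcal{H}$, $\mathcal{B}_1(\mathcal{H})$ the trace class, and $\mathcal{D}(\mathcal{H})$ the set of states, i.e. positive $\rho\in\mathcal{B}_1(\mathcal{H})$ with $\operatorname{tr}(\rho)=1$. A quantum operation is a completely positive, trace-preserving linear map on $\mathcal{B}_1(\mathcal{H})$. A dynamical quantum system is a strongly continuous semigroup $\{\Psi_t\}_{t\ge0}$ of quantum operations on $\mathcal{B}_1(\mathcal{H})$ ($\Psi_s\Psi_t=\Psi_{s+t}$, $\Psi_0=I$, $t\mapsto\Psi_t(T)$ trace-norm continuous on $[0,\infty)$ for each $T$). For a single quantum operation $\Psi$ put $\mathcal{C}^\Psi=\{A\in\mathcal{B}(\mathcal{H})\mid\operatorname{tr}(\Psi(\rho)A)=\operatorname{tr}(\rho A)\text{ for all }\rho\in\mathcal{D}(\mathcal{H})\}$ and $\mathcal{C}^\Psi_2=\{A\mid A,A^*A,AA^*\in\mathcal{C}^\Psi\}$; $\mathcal{C}^\Psi_{\mathrm{p}}=\{A\mid p(A,A^* )\in\mathcal{C}^\Psi\text{ for all complex polynomials }p\text{ in two noncommutative variables}\}$; $\mathcal{C}^\Psi_{\mathrm{c}}=\{A\mid C^*(I,A)\subseteq\mathcal{C}^\Psi\}$, with $C^*(I,A)$ the $C^*$-algebra generated by $I$ and $A$; $\mathcal{C}^\Psi_{\mathrm{w}}=\{A\mid W^*(A)\subseteq\mathcal{C}^\Psi\}$, with $W^*(A)$ the von Neumann algebra generated by $A$ (here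 $A\in\mathcal{B}(\mathcal{H})$). For the system $\mathbf{\Psi}$, the set of constants is $\mathcal{C}^{\mathbf{\Psi}}=\{A\in\mathcal{B}(\mathcal{H})\mid\operatorname{tr}(\Psi_t(\rho)A)=\operatorname{tr}(\rho A)\text{ for all }\rho\in\mathcal{D}(\mathcal{H}),\ t\ge0\}$, and $\mathcal{C}^{\mathbf{\Psi}}_\bullet=\bigcap_{t\geq0}\mathcal{C}^{\Psi_t}_\bullet$ for $\bullet=2,\mathrm{p},\mathrm{c},\mathrm{w}$. *)

theory Defs
  imports "HOL-Analysis.Analysis" "HOL-Library.Poly_Mapping"
begin

text \<open>Complex Hilbert spaces of arbitrary (possibly zero, possibly uncountable) dimension.
  The inner product is antilinear in its first argument.\<close>

class chilbert_space = banach +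
  fixes scaleC :: "complex \<Rightarrow> 'a \<Rightarrow> 'a" (infixr \<open>*\<^sub>C\<close> 75)
    and cinner :: "'a \<Rightarrow> 'a \<Rightarrow> complex"
  assumes scaleC_add_right: "c *\<^sub>C (x + y) = c *\<^sub>C x + c *\<^sub>C y"
    and scaleC_add_left: "(c + d) *\<^sub>C x = c *\<^sub>C x + d *\<^sub>C x"
    and scaleC_scaleC: "c *\<^sub>C d *\<^sub>C x = (c * d) *\<^sub>C x"
    and scaleC_of_real: "complex_of_real r *\<^sub>C x = r *\<^sub>R x"
    and cinner_commute: "cinner x y = cnj (cinner y x)"
    and cinner_add_right: "cinner x (y + z) = cinner x y + cinner x z"
    and cinner_scaleC_right: "cinner x (c *\<^sub>C y) = c * cinner x y"
    and cinner_self: "cinner x x = complex_of_real ((norm x)\<^sup>2)"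

lemma cinner_scaleC_left: "cinner (c *\<^sub>C x) y = cnj c * cinner x y"
  for x y :: "'a::chilbert_space"
  by (metis cinner_commute cinner_scaleC_right complex_cnj_mult)

lemma norm_scaleC: "norm (c *\<^sub>C x) = cmod c * norm x" for x :: "'a::chilbert_space"
proof -
  have "complex_of_real ((norm (c *\<^sub>C x))\<^sup>2) = (c * cnj c) * cinner x x"
    by (simp only: cinner_self[symmetric] cinner_scaleC_left cinner_scaleC_right mult_ac)
  also have "\<dots> = complex_of_real ((cmod c * norm x)\<^sup>2)"
    by (simp only: cinner_self complex_norm_square[symmetric] power_mult_distrib of_real_mult of_real_power)
  finally have "(norm (c *\<^sub>C x))\<^sup>2 = (cmod c * norm x)\<^sup>2"
    using of_real_eq_iff by blast
  then show ?thesis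
    by (simp add: power2_eq_iff_nonneg)
qed

lemma bounded_linear_scaleC: "bounded_linear (\<lambda>x::'a::chilbert_space. c *\<^sub>C x)"
proof (rule bounded_linear_intro)
  fix r :: real and x y :: 'a
  show "c *\<^sub>C (x + y) = c *\<^sub>C x + c *\<^sub>C y"
    by (rule scaleC_add_right)
  show "c *\<^sub>C r *\<^sub>R x = r *\<^sub>R c *\<^sub>C x"
    by (simp add: scaleC_of_real[symmetric] scaleC_scaleC mult.commute)
  show "norm (c *\<^sub>C x) \<le> norm x * cmod c"
    by (simp add: norm_scaleC)
qed


section \<open>Bounded operators\<close>

type_synonym 'a operator = "'a \<Rightarrow>\<^sub>L 'a"

text \<open>The type \<open>'a \<Rightarrow>\<^sub>L 'a\<close> consists of the bounded real-linear maps; B(H) is the set of the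
  complex-linear ones, with the operator norm and topology of the ambient type.\<close>

definition bounded_ops :: "'a::chilbert_space operator set" where
  "bounded_ops = {A. \<forall>c x. blinfun_apply A (c *\<^sub>C x) = c *\<^sub>C blinfun_apply A x}"

lift_definition scaleC_op :: "complex \<Rightarrow> 'a::chilbert_space operator \<Rightarrow> 'a operator"
  is "\<lambda>c f x. c *\<^sub>C f x"
  using bounded_linear_compose[OF bounded_linear_scaleC] by blast

definition adj_op :: "'a::chilbert_space operator \<Rightarrow> 'a operator" where
  "adj_op A = (THE B. B \<in> bounded_ops \<and> (\<forall>x y. cinner (B x) y = cinner x (A y)))"

definition positive_op :: "'a::chilbert_space operator \<Rightarrow> bool" where
  "positive_op A \<longleftrightarrow> A \<in> bounded_ops \<and> (\<forall>x. cinner x (A x) \<in> \<real>\<^sub>\<ge>\<^sub>0)"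

definition abs_op :: "'a::chilbert_space operator \<Rightarrow> 'a operator" where
  "abs_op A = (THE P. positive_op P \<and> P o\<^sub>L P = adj_op A o\<^sub>L A)"


section \<open>Trace class and states\<close>

definition is_onb :: "'a::chilbert_space set \<Rightarrow> bool" where
  "is_onb E \<longleftrightarrow> (\<forall>e\<in>E. \<forall>f\<in>E. cinner e f = (if e = f then 1 else 0)) \<and>
    (\<forall>x. (\<forall>e\<in>E. cinner e x = 0) \<longrightarrow> x = 0)"

definition some_onb :: "'a::chilbert_space set" where
  "some_onb = (SOME E. is_onb E)"

definition trace_class :: "'a::chilbert_space operator set" where
  "trace_class = {T \<in> bounded_ops. (\<lambda>e. cinner e (abs_op T e)) summable_on some_onb}"

definition op_trace :: "'a::chilbert_space operator \<Rightarrow> complex" where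
  "op_trace T = (\<Sum>\<^sub>\<infinity>e\<in>some_onb. cinner e (T e))"

definition trace_norm :: "'a::chilbert_space operator \<Rightarrow> real" where
  "trace_norm T = Re (op_trace (abs_op T))"

definition states :: "'a::chilbert_space operator set" where
  "states = {\<rho> \<in> trace_class. positive_op \<rho> \<and> op_trace \<rho> = 1}"


section \<open>Quantum operations and dynamical quantum systems\<close>

text \<open>Positivity of the operator on the n-fold direct sum of H given by an n-by-n matrix of
  operators on H.\<close>

definition positive_block :: "nat \<Rightarrow> (nat \<Rightarrow> nat \<Rightarrow> 'a::chilbert_space operator) \<Rightarrow> bool" where
  "positive_block n T \<longleftrightarrow> (\<forall>i<n. \<forall>j<n. T i j \<in> bounded_ops) \<and>
    (\<forall>x :: nat \<Rightarrow> 'a. (\<Sum>i<n. \<Sum>j<n. cinner (x i) (T i j (x j))) \<in> \<real>\<^sub>\<ge>\<^sub>0)"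

text \<open>Maps on the trace class are functions on the whole operator type of which only the
  restriction to \<open>trace_class\<close> is relevant.\<close>

definition completely_positive :: "('a::chilbert_space operator \<Rightarrow> 'a operator) \<Rightarrow> bool" where
  "completely_positive \<Phi> \<longleftrightarrow>
    (\<forall>n T. (\<forall>i<n. \<forall>j<n. T i j \<in> trace_class) \<and> positive_block n T \<longrightarrow>
      positive_block n (\<lambda>i j. \<Phi> (T i j)))"

definition quantum_operation :: "('a::chilbert_space operator \<Rightarrow> 'a operator) \<Rightarrow> bool" where
  "quantum_operation \<Phi> \<longleftrightarrow>
    (\<forall>T\<in>trace_class. \<Phi> T \<in> trace_class) \<and>
    (\<forall>S\<in>trace_class. \<forall>T\<in>trace_class. \<Phi> (S + T) = \<Phi> S + \<Phi> T) \<and>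
    (\<forall>c. \<forall>T\<in>trace_class. \<Phi> (scaleC_op c T) = scaleC_op c (\<Phi> T)) \<and>
    completely_positive \<Phi> \<and>
    (\<forall>T\<in>trace_class. op_trace (\<Phi> T) = op_trace T)"

definition dynamical_quantum_system ::
    "(real \<Rightarrow> 'a::chilbert_space operator \<Rightarrow> 'a operator) \<Rightarrow> bool" where
  "dynamical_quantum_system \<Psi> \<longleftrightarrow>
    (\<forall>t\<ge>0. quantum_operation (\<Psi> t)) \<and>
    (\<forall>s\<ge>0. \<forall>t\<ge>0. \<forall>T\<in>trace_class. \<Psi> s (\<Psi> t T) = \<Psi> (s + t) T) \<and>
    (\<forall>T\<in>trace_class. \<Psi> 0 T = T) \<and>
    (\<forall>T\<in>trace_class. \<forall>s\<ge>0. ((\<lambda>t. trace_norm (\<Psi> t T - \<Psi> s T)) \<longlongrightarrow> 0) (at s within {0..}))"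


section \<open>Operator algebras on H\<close>

definition star_algebra :: "'a::chilbert_space operator set \<Rightarrow> bool" where
  "star_algebra M \<longleftrightarrow> M \<subseteq> bounded_ops \<and> 0 \<in> M \<and>
    (\<forall>A\<in>M. \<forall>B\<in>M. A + B \<in> M) \<and>
    (\<forall>c. \<forall>A\<in>M. scaleC_op c A \<in> M) \<and>
    (\<forall>A\<in>M. \<forall>B\<in>M. A o\<^sub>L B \<in> M) \<and>
    (\<forall>A\<in>M. adj_op A \<in> M)"

definition cstar_algebra :: "'a::chilbert_space operator set \<Rightarrow> bool" where
  "cstar_algebra M \<longleftrightarrow> star_algebra M \<and> closed M"

definition commutant :: "'a::chilbert_space operator set \<Rightarrow> 'a operator set" where
  "commutant M = {B \<in> bounded_ops. \<forall>A\<in>M. A o\<^sub>L B = B o\<^sub>L A}"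

definition von_neumann_algebra :: "'a::chilbert_space operator set \<Rightarrow> bool" where
  "von_neumann_algebra M \<longleftrightarrow> star_algebra M \<and> commutant (commutant M) = M"


section \<open>Polynomials in an operator and its adjoint\<close>

text \<open>A polynomial in two noncommuting variables is a finitely supported family of coefficients
  indexed by the words in the two letters (the empty word gives the constant term).\<close>

datatype letter = Var1 | Var2

type_synonym nc_poly = "letter list \<Rightarrow>\<^sub>0 complex"

fun eval_word :: "'a::chilbert_space operator \<Rightarrow> 'a operator \<Rightarrow> letter list \<Rightarrow> 'a operator" where
  "eval_word A B [] = id_blinfun"
| "eval_word A B (Var1 # w) = A o\<^sub>L eval_word A B w"
| "eval_word A B (Var2 # w) = B o\<^sub>L eval_word A B w"

definition eval_nc_poly :: "nc_poly \<Rightarrow> 'a::chilbert_space operator \<Rightarrow> 'a operator \<Rightarrow> 'a operator" where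
  "eval_nc_poly p A B =
    (\<Sum>w\<in>Poly_Mapping.keys p. scaleC_op (Poly_Mapping.lookup p w) (eval_word A B w))"


section \<open>Constants\<close>

definition constants :: "('a::chilbert_space operator \<Rightarrow> 'a operator) \<Rightarrow> 'a operator set" where
  "constants \<Phi> = {A \<in> bounded_ops. \<forall>\<rho>\<in>states. op_trace (\<Phi> \<rho> o\<^sub>L A) = op_trace (\<rho> o\<^sub>L A)}"

definition constants_2 :: "('a::chilbert_space operator \<Rightarrow> 'a operator) \<Rightarrow> 'a operator set" where
  "constants_2 \<Phi> = {A \<in> bounded_ops. A \<in> constants \<Phi> \<and>
    adj_op A o\<^sub>L A \<in> constants \<Phi> \<and> A o\<^sub>L adj_op A \<in> constants \<Phi>}"

definition constants_p :: "('a::chilbert_space operator \<Rightarrow> 'a operator) \<Rightarrow> 'a operator set" where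
  "constants_p \<Phi> = {A \<in> bounded_ops. \<forall>p. eval_nc_poly p A (adj_op A) \<in> constants \<Phi>}"

definition constants_c :: "('a::chilbert_space operator \<Rightarrow> 'a operator) \<Rightarrow> 'a operator set" where
  "constants_c \<Phi> = {A \<in> bounded_ops. cstar_algebra hull {id_blinfun, A} \<subseteq> constants \<Phi>}"

definition constants_w :: "('a::chilbert_space operator \<Rightarrow> 'a operator) \<Rightarrow> 'a operator set" where
  "constants_w \<Phi> = {A \<in> bounded_ops. von_neumann_algebra hull {A} \<subseteq> constants \<Phi>}"

definition sys_constants :: "(real \<Rightarrow> 'a::chilbert_space operator \<Rightarrow> 'a operator) \<Rightarrow> 'a operator set" where
  "sys_constants \<Psi> = {A \<in> bounded_ops.
    \<forall>\<rho>\<in>states. \<forall>t\<ge>0. op_trace (\<Psi> t \<rho> o\<^sub>L A) = op_trace (\<rho> o\<^sub>L A)}"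

definition sys_constants_2 :: "(real \<Rightarrow> 'a::chilbert_space operator \<Rightarrow> 'a operator) \<Rightarrow> 'a operator set" where
  "sys_constants_2 \<Psi> = (\<Inter>t\<in>{0..}. constants_2 (\<Psi> t))"

definition sys_constants_p :: "(real \<Rightarrow> 'a::chilbert_space operator \<Rightarrow> 'a operator) \<Rightarrow> 'a operator set" where
  "sys_constants_p \<Psi> = (\<Inter>t\<in>{0..}. constants_p (\<Psi> t))"

definition sys_constants_c :: "(real \<Rightarrow> 'a::chilbert_space operator \<Rightarrow> 'a operator) \<Rightarrow> 'a operator set" where
  "sys_constants_c \<Psi> = (\<Inter>t\<in>{0..}. constants_c (\<Psi> t))"

definition sys_constants_w :: "(real \<Rightarrow> 'a::chilbert_space operator \<Rightarrow> 'a operator) \<Rightarrow> 'a operator set" where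
  "sys_constants_w \<Psi> = (\<Inter>t\<in>{0..}. constants_w (\<Psi> t))"

end

theory Submission
  imports Defs
begin

text \<open>Each of the sets attached to the system is the intersection over \<open>t\<close> of the corresponding set
  for the single quantum operation \<open>\<Psi> t\<close>. The key fact is that, for one quantum operation
  \<open>\<Phi>\<close>, the set \<open>constants_2 \<Phi>\<close> is the commutant of a self-adjoint set \<open>kraus_ops \<Phi>\<close> of
  bounded operators (\<open>constants_2_eq_commutant\<close>). An intersection of commutants is the commutant of
  the union, so \<open>sys_constants_2 \<Psi>\<close> is a von Neumann algebra with identity. If it contains
  \<open>A\<close>, then it contains the von Neumann algebra generated by \<open>A\<close>, and with it the C*-algebra
  generated by \<open>1\<close> and \<open>A\<close> and all polynomials in \<open>A\<close> and its adjoint. The monomials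
  \<open>A\<close>, \<open>A\<^sup>* A\<close> and \<open>A A\<^sup>*\<close> lead back to \<open>constants_2\<close>. For the second part,
  the constants are closed under adjoints, so stability under products forces \<open>A\<^sup>* A\<close> and
  \<open>A A\<^sup>*\<close> to be constants whenever \<open>A\<close> is one.

  If \<open>\<Phi>(\<rho>) = \<Sum> K\<^sub>i \<rho> K\<^sub>i\<^sup>*\<close>, the commutant in question is that of the \<open>K\<^sub>i\<close> and their
  adjoints. Instead of decomposing \<open>\<Phi>\<close>, one can use the operators \<open>x \<mapsto> \<Phi>(|x\<rangle>\<langle>u|) v\<close>, which
  are combinations of the \<open>K\<^sub>i\<close>. That \<open>A\<close> commutes with all of them means
  \<open>\<Phi>(|A x\<rangle>\<langle>u|) = A \<Phi>(|x\<rangle>\<langle>u|)\<close>.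
  Taking traces for \<open>u = x\<close>, this implies that \<open>A\<close> is a constant as far as the states
  \<open>|x\<rangle>\<langle>x|\<close> can tell, and \<open>constantI\<close> extends this to all states by approximation
  in trace. Conversely, if \<open>A\<close>, its adjoint and \<open>A\<^sup>* A\<close> are constants, then a nonnegative
  quadratic expression supplied by complete positivity has trace zero; hence it vanishes, and the
  Cauchy--Schwarz inequality for the positive kernel
  \<open>\<langle>w, \<Phi>(|z\<rangle>\<langle>z'|) w'\<rangle>\<close> turns this into the commutation relation (\<open>kraus_commute\<close>).

  The analytic input is small: orthonormal bases and Parseval's identity, adjoints, square roots
  of positive operators, and the cyclicity \<open>tr (T A) = tr (A T)\<close> for operators \<open>T\<close> in the span
  of the positive trace class operators.\<close>

section \<open>Inner products\<close>

lemma scaleC_zero_left [simp]: "0 *\<^sub>C x = 0" for x :: "'a::chilbert_space"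
  using scaleC_of_real[of 0 x] by simp

lemma scaleC_one [simp]: "1 *\<^sub>C x = x" for x :: "'a::chilbert_space"
  using scaleC_of_real[of 1 x] by simp

lemma scaleC_zero_right [simp]: "c *\<^sub>C 0 = 0" for c :: complex
  using linear_0[OF bounded_linear.linear[OF bounded_linear_scaleC]] .

lemma scaleC_minus_right: "c *\<^sub>C (- x) = - (c *\<^sub>C x)" for x :: "'a::chilbert_space"
  using linear_neg[OF bounded_linear.linear[OF bounded_linear_scaleC]] .

lemma scaleC_minus_left: "(- c) *\<^sub>C x = - (c *\<^sub>C x)" for x :: "'a::chilbert_space"
  using scaleC_add_left[of c "- c" x] by (simp add: eq_neg_iff_add_eq_0 add.commute)

lemma scaleC_diff_right: "c *\<^sub>C (x - y) = c *\<^sub>C x - c *\<^sub>C y" for x y :: "'a::chilbert_space"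
  using linear_diff[OF bounded_linear.linear[OF bounded_linear_scaleC]] .

lemma cinner_add_left: "cinner (x + y) z = cinner x z + cinner y z"
  for x y z :: "'a::chilbert_space"
  by (metis cinner_add_right cinner_commute complex_cnj_add)

lemma cinner_zero_right [simp]: "cinner x 0 = 0" for x :: "'a::chilbert_space"
  using cinner_add_right[of x 0 0] by simp

lemma cinner_zero_left [simp]: "cinner 0 x = 0" for x :: "'a::chilbert_space"
  using cinner_add_left[of 0 0 x] by simp

lemma cinner_minus_right: "cinner x (- y) = - cinner x y" for x y :: "'a::chilbert_space"
  using cinner_add_right[of x y "- y"] by (simp add: eq_neg_iff_add_eq_0 add.commute)

lemma cinner_minus_left: "cinner (- x) y = - cinner x y" for x y :: "'a::chilbert_space"
  using cinner_add_left[of x "- x" y] by (simp add: eq_neg_iff_add_eq_0 add.commute)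

lemma cinner_diff_right: "cinner x (y - z) = cinner x y - cinner x z"
  for x y z :: "'a::chilbert_space"
  using cinner_add_right[of x y "- z"] by (simp add: cinner_minus_right)

lemma cinner_diff_left: "cinner (x - y) z = cinner x z - cinner y z"
  for x y z :: "'a::chilbert_space"
  using cinner_add_left[of x "- y" z] by (simp add: cinner_minus_left)

lemma cinner_sum_right: "cinner x (\<Sum>i\<in>I. f i) = (\<Sum>i\<in>I. cinner x (f i))"
  for x :: "'a::chilbert_space"
  by (induction I rule: infinite_finite_induct) (auto simp: cinner_add_right)

lemma cinner_sum_left: "cinner (\<Sum>i\<in>I. f i) x = (\<Sum>i\<in>I. cinner (f i) x)"
  for x :: "'a::chilbert_space"
  by (induction I rule: infinite_finite_induct) (auto simp: cinner_add_left)

lemma cinner_scaleR_right: "cinner x (r *\<^sub>R y) = of_real r * cinner x y"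
  for x y :: "'a::chilbert_space"
  by (simp add: scaleC_of_real[symmetric] cinner_scaleC_right)

lemma cinner_scaleR_left: "cinner (r *\<^sub>R x) y = of_real r * cinner x y"
  for x y :: "'a::chilbert_space"
  by (simp add: scaleC_of_real[symmetric] cinner_scaleC_left)

lemmas cinner_bilinear =
  cinner_add_left cinner_add_right cinner_diff_left cinner_diff_right
  cinner_minus_left cinner_minus_right cinner_scaleC_left cinner_scaleC_right

lemma cinner_eq_zero_iff [simp]: "cinner x x = 0 \<longleftrightarrow> x = 0" for x :: "'a::chilbert_space"
  by (simp add: cinner_self)

lemma cinner_ext:
  fixes x y :: "'a::chilbert_space"
  assumes "\<And>z. cinner z x = cinner z y"
  shows "x = y"
  using assms[of "x - y"] cinner_eq_zero_iff[of "x - y"] by (simp add: cinner_diff_right)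

lemma cinner_ext_left:
  fixes x y :: "'a::chilbert_space"
  assumes "\<And>z. cinner x z = cinner y z"
  shows "x = y"
  using assms by (metis cinner_commute cinner_ext)

lemma cnj_mult_self: "cnj z * z = complex_of_real ((cmod z)\<^sup>2)"
  by (simp only: complex_norm_square mult.commute)

lemma Re_scaled_cnj_mult_self: "Re (complex_of_real r * cnj z * z) = r * (cmod z)\<^sup>2"
  by (simp only: mult.assoc cnj_mult_self of_real_mult[symmetric] Re_complex_of_real)

text \<open>Every Cauchy--Schwarz inequality below, for the inner product, for a positive operator and
  for the kernel of a completely positive map, is the nonpositivity of the discriminant of a
  nonnegative quadratic form in one complex variable.\<close>

lemma quadratic_discriminant:
  fixes a d :: real and b :: complex
  assumes nonneg: "\<And>c. 0 \<le> a + 2 * Re (c * b) + (cmod c)\<^sup>2 * d" and "0 \<le> d"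
  shows "(cmod b)\<^sup>2 \<le> a * d"
proof (cases "d = 0")
  case True
  have "b = 0"
  proof (rule ccontr)
    assume "b \<noteq> 0"
    define t where "t = (a + 1) / (2 * (cmod b)\<^sup>2)"
    have "Re (complex_of_real (- t) * cnj b * b) = - t * (cmod b)\<^sup>2"
      by (rule Re_scaled_cnj_mult_self)
    moreover have "t * (cmod b)\<^sup>2 = (a + 1) / 2"
      using \<open>b \<noteq> 0\<close> by (simp add: t_def)
    ultimately show False
      using nonneg[of "complex_of_real (- t) * cnj b"] True by simp
  qed
  then show ?thesis using True by simp
next
  case False
  then have d: "d > 0" using \<open>0 \<le> d\<close> by simp
  define c where "c = complex_of_real (- 1 / d) * cnj b"
  have "Re (c * b) = - (cmod b)\<^sup>2 / d"
    unfolding c_def Re_scaled_cnj_mult_self by simp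
  moreover have "(cmod c)\<^sup>2 * d = (cmod b)\<^sup>2 / d"
    using d by (simp add: c_def norm_mult norm_divide power_mult_distrib power_divide power2_eq_square)
  ultimately have "0 \<le> a - (cmod b)\<^sup>2 / d"
    using nonneg[of c] by simp
  then show ?thesis
    using d by (simp add: field_simps)
qed

lemma norm_add_square:
  fixes x y :: "'a::chilbert_space"
  shows "(norm (x + y))\<^sup>2 = (norm x)\<^sup>2 + 2 * Re (cinner x y) + (norm y)\<^sup>2"
proof -
  have "complex_of_real ((norm (x + y))\<^sup>2) = cinner (x + y) (x + y)"
    by (simp only: cinner_self)
  also have "\<dots> = cinner x x + (cinner x y + cnj (cinner x y)) + cinner y y"
    by (simp add: cinner_add_left cinner_add_right cinner_commute[of y x])
  also have "\<dots> = complex_of_real ((norm x)\<^sup>2 + 2 * Re (cinner x y) + (norm y)\<^sup>2)"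
    by (simp add: cinner_self complex_add_cnj)
  finally show ?thesis
    by (simp only: of_real_eq_iff)
qed

lemma cinner_Cauchy_Schwarz: "cmod (cinner x y) \<le> norm x * norm y"
  for x y :: "'a::chilbert_space"
proof -
  have "(cmod (cinner x y))\<^sup>2 \<le> (norm x)\<^sup>2 * (norm y)\<^sup>2"
  proof (rule quadratic_discriminant)
    fix c
    show "0 \<le> (norm x)\<^sup>2 + 2 * Re (c * cinner x y) + (cmod c)\<^sup>2 * (norm y)\<^sup>2"
      using norm_add_square[of x "c *\<^sub>C y"] zero_le_power2[of "norm (x + c *\<^sub>C y)"]
      by (simp add: cinner_scaleC_right norm_scaleC power_mult_distrib)
  qed simp
  then have "(cmod (cinner x y))\<^sup>2 \<le> (norm x * norm y)\<^sup>2"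
    by (simp only: power_mult_distrib)
  then show ?thesis
    by (rule power2_le_imp_le) simp
qed

lemma bounded_linear_cinner_right: "bounded_linear (cinner x)" for x :: "'a::chilbert_space"
  by (rule bounded_linear_intro[where K = "norm x"])
    (use cinner_Cauchy_Schwarz[of x] in
      \<open>auto simp: cinner_add_right cinner_scaleR_right scaleR_conv_of_real mult.commute\<close>)

lemma bounded_linear_cinner_left: "bounded_linear (\<lambda>x. cinner x y)" for y :: "'a::chilbert_space"
  by (rule bounded_linear_intro[where K = "norm y"])
    (use cinner_Cauchy_Schwarz[of _ y] in
      \<open>auto simp: cinner_add_left cinner_scaleR_left scaleR_conv_of_real mult.commute\<close>)


section \<open>Orthonormal bases\<close>

definition orthonormal :: "'a::chilbert_space set \<Rightarrow> bool" where
  "orthonormal E \<longleftrightarrow> (\<forall>e\<in>E. \<forall>f\<in>E. cinner e f = (if e = f then 1 else 0))"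

lemma orthonormal_coeff:
  assumes "orthonormal E" "F \<subseteq> E" "finite F" "e \<in> E"
  shows "cinner e (\<Sum>f\<in>F. c f *\<^sub>C f) = (if e \<in> F then c e else 0)"
proof -
  have "cinner e (\<Sum>f\<in>F. c f *\<^sub>C f) = (\<Sum>f\<in>F. if f = e then c f else 0)"
    using assms unfolding cinner_sum_right orthonormal_def
    by (intro sum.cong) (auto simp: cinner_scaleC_right)
  also have "\<dots> = (if e \<in> F then c e else 0)"
    using assms by simp
  finally show ?thesis .
qed

lemma orthonormal_norm_sum:
  assumes "orthonormal E" "F \<subseteq> E" "finite F"
  shows "(norm (\<Sum>e\<in>F. c e *\<^sub>C e))\<^sup>2 = (\<Sum>e\<in>F. (cmod (c e))\<^sup>2)"
proof -
  let ?s = "\<Sum>e\<in>F. c e *\<^sub>C e"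
  have "complex_of_real ((norm ?s)\<^sup>2) = (\<Sum>e\<in>F. cnj (c e) * cinner e ?s)"
    by (simp only: cinner_self[symmetric] cinner_sum_left[of _ F] cinner_scaleC_left)
  also have "\<dots> = (\<Sum>e\<in>F. cnj (c e) * c e)"
    using assms by (intro sum.cong refl) (subst orthonormal_coeff[OF assms], auto)
  also have "\<dots> = complex_of_real (\<Sum>e\<in>F. (cmod (c e))\<^sup>2)"
    by (simp only: of_real_sum complex_norm_square mult.commute)
  finally show ?thesis
    by (simp only: of_real_eq_iff)
qed

text \<open>The Riesz--Fischer theorem. The tails of the series are Cauchy because, by orthogonality, the
  squared norm of a finite partial sum is the corresponding partial sum of squares.\<close>

lemma orthonormal_series_summable:
  fixes E :: "'a::chilbert_space set"
  assumes E: "orthonormal E" and sq: "(\<lambda>e. (cmod (c e))\<^sup>2) summable_on E"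
  shows "(\<lambda>e. c e *\<^sub>C e) summable_on E"
proof -
  let ?q = "\<lambda>e. (cmod (c e))\<^sup>2" and ?f = "\<lambda>e. c e *\<^sub>C e"
  have diff: "dist (sum ?f F) (sum ?f G) < \<epsilon>"
    if "finite F" "F \<subseteq> E" "G \<subseteq> F" "sum ?q F - sum ?q G < \<epsilon>\<^sup>2" "\<epsilon> > 0" for F G \<epsilon>
  proof -
    have "sum ?f F - sum ?f G = sum ?f (F - G)"
      using that by (simp add: sum_diff)
    then have "(dist (sum ?f F) (sum ?f G))\<^sup>2 = sum ?q (F - G)"
      unfolding dist_norm using that by (simp add: orthonormal_norm_sum[OF E] subset_iff)
    also have "\<dots> < \<epsilon>\<^sup>2"
      using that by (simp add: sum_diff)
    finally show ?thesis
      using \<open>\<epsilon> > 0\<close> by (simp add: power_less_imp_less_base)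
  qed
  obtain L where L: "(sum ?q \<longlongrightarrow> L) (finite_subsets_at_top E)"
    using sq unfolding has_sum_def summable_on_def by blast
  have "\<exists>P. eventually P (finite_subsets_at_top E) \<and>
              (\<forall>F F'. P F \<and> P F' \<longrightarrow> dist (sum ?f F) (sum ?f F') < \<epsilon>)" if "\<epsilon> > 0" for \<epsilon>
  proof -
    have "\<forall>\<^sub>F F in finite_subsets_at_top E. dist (sum ?q F) L < (\<epsilon>/2)\<^sup>2 / 2"
      by (rule tendstoD[OF L]) (use \<open>\<epsilon> > 0\<close> in simp)
    then have "\<exists>F0. finite F0 \<and> F0 \<subseteq> E \<and>
        (\<forall>F. finite F \<and> F0 \<subseteq> F \<and> F \<subseteq> E \<longrightarrow> dist (sum ?q F) L < (\<epsilon>/2)\<^sup>2 / 2)"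
      by (simp only: eventually_finite_subsets_at_top)
    then obtain F0 where F0: "finite F0" "F0 \<subseteq> E"
      and close: "\<And>F. finite F \<Longrightarrow> F0 \<subseteq> F \<Longrightarrow> F \<subseteq> E \<Longrightarrow> dist (sum ?q F) L < (\<epsilon>/2)\<^sup>2 / 2"
      by auto
    have near: "dist (sum ?f F) (sum ?f F0) < \<epsilon>/2" if "finite F" "F0 \<subseteq> F" "F \<subseteq> E" for F
    proof (rule diff)
      show "sum ?q F - sum ?q F0 < (\<epsilon>/2)\<^sup>2"
        using close[OF that] close[OF F0(1) order_refl F0(2)] unfolding dist_real_def by linarith
    qed (use that \<open>\<epsilon> > 0\<close> in auto)
    have "eventually (\<lambda>F. finite F \<and> F0 \<subseteq> F \<and> F \<subseteq> E) (finite_subsets_at_top E)"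
      using F0 by (auto simp: eventually_finite_subsets_at_top)
    moreover have "dist (sum ?f F) (sum ?f F') < \<epsilon>"
      if "finite F \<and> F0 \<subseteq> F \<and> F \<subseteq> E" "finite F' \<and> F0 \<subseteq> F' \<and> F' \<subseteq> E" for F F'
      using near[of F] near[of F'] that dist_triangle2[of "sum ?f F" "sum ?f F'" "sum ?f F0"]
      by simp
    ultimately show ?thesis
      by (intro exI[of _ "\<lambda>F. finite F \<and> F0 \<subseteq> F \<and> F \<subseteq> E"] conjI allI impI) auto
  qed
  then have "cauchy_filter (filtermap (sum ?f) (finite_subsets_at_top E))"
    by (simp add: cauchy_filter_metric_filtermap)
  moreover have "complete (UNIV::'a set)"
    by (meson Cauchy_convergent UNIV_I complete_def convergent_def)
  ultimately obtain L' where "(sum ?f \<longlongrightarrow> L') (finite_subsets_at_top E)"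
    using complete_uniform[where S=UNIV] by (force simp add: filterlim_def)
  then show ?thesis
    using summable_on_def has_sum_def by blast
qed

lemma is_onb_some_onb: "is_onb (some_onb :: 'a::chilbert_space set)"
proof -
  have "\<exists>M\<in>{E :: 'a set. orthonormal E}. \<forall>X\<in>{E. orthonormal E}. M \<subseteq> X \<longrightarrow> X = M"
  proof (rule subset_Zorn')
    fix C :: "'a set set" assume C: "subset.chain {E. orthonormal E} C"
    have "cinner e f = (if e = f then 1 else 0)" if "e \<in> X" "X \<in> C" "f \<in> Y" "Y \<in> C" for e f X Y
    proof -
      have "X \<subseteq> Y \<or> Y \<subseteq> X" "orthonormal X" "orthonormal Y"
        using C that by (auto simp: subset_chain_def)
      then show ?thesis
        using that unfolding orthonormal_def by (meson subsetD)
    qed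
    then show "\<Union>C \<in> {E. orthonormal E}"
      unfolding orthonormal_def by blast
  qed
  then obtain M :: "'a set" where M: "orthonormal M"
    and maximal: "\<And>X. orthonormal X \<Longrightarrow> M \<subseteq> X \<Longrightarrow> X = M" by auto
  have "x = 0" if x: "\<forall>e\<in>M. cinner e x = 0" for x
  proof (rule ccontr)
    assume "x \<noteq> 0"
    define u where "u = (1 / norm x) *\<^sub>R x"
    have "norm u = 1"
      using \<open>x \<noteq> 0\<close> by (simp add: u_def)
    then have uu: "cinner u u = 1"
      by (simp add: cinner_self)
    have eu: "cinner e u = 0" "cinner u e = 0" if "e \<in> M" for e
      using x that cinner_commute[of u e] by (auto simp: u_def cinner_scaleR_right)
    have "u \<notin> M"
      using eu uu by force
    moreover have "orthonormal (insert u M)"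
      using M uu eu \<open>u \<notin> M\<close> unfolding orthonormal_def by auto
    ultimately show False
      using maximal[of "insert u M"] by blast
  qed
  with M have "is_onb M"
    unfolding is_onb_def orthonormal_def by blast
  then show ?thesis
    unfolding some_onb_def by (rule someI)
qed

lemma orthonormal_some_onb: "orthonormal some_onb"
  using is_onb_some_onb unfolding is_onb_def orthonormal_def by blast

lemma some_onb_total: "(\<And>e. e \<in> some_onb \<Longrightarrow> cinner e x = 0) \<Longrightarrow> x = 0"
  using is_onb_some_onb unfolding is_onb_def by blast

lemma Bessel:
  assumes E: "orthonormal E" and "F \<subseteq> E" "finite F"
  shows "(\<Sum>e\<in>F. (cmod (cinner e x))\<^sup>2) \<le> (norm x)\<^sup>2"
proof -
  let ?s = "\<Sum>e\<in>F. cinner e x *\<^sub>C e"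
  have "cinner ?s x = (\<Sum>e\<in>F. cnj (cinner e x) * cinner e x)"
    by (simp add: cinner_sum_left cinner_scaleC_left)
  also have "\<dots> = complex_of_real (\<Sum>e\<in>F. (cmod (cinner e x))\<^sup>2)"
    by (simp only: of_real_sum complex_norm_square mult.commute)
  finally have "Re (cinner (- ?s) x) = - (\<Sum>e\<in>F. (cmod (cinner e x))\<^sup>2)"
    by (simp add: cinner_minus_left)
  then show ?thesis
    using norm_add_square[of "- ?s" x] zero_le_power2[of "norm (- ?s + x)"]
      orthonormal_norm_sum[OF assms, of "\<lambda>e. cinner e x"] by simp
qed

lemma Bessel_summable:
  assumes "orthonormal E"
  shows "(\<lambda>e. (cmod (cinner e x))\<^sup>2) summable_on E"
  using Bessel[OF assms] by (intro nonneg_bdd_above_summable_on bdd_aboveI2) auto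

lemma onb_expansion: "((\<lambda>e. cinner e x *\<^sub>C e) has_sum x) some_onb"
proof -
  let ?f = "\<lambda>e. cinner e x *\<^sub>C e"
  have f: "(?f has_sum infsum ?f some_onb) some_onb"
    by (intro has_sum_infsum orthonormal_series_summable orthonormal_some_onb
        Bessel_summable)
  have "cinner e (x - infsum ?f some_onb) = 0" if e: "e \<in> some_onb" for e
  proof -
    have "((\<lambda>g. cinner e (?f g)) has_sum cinner e (infsum ?f some_onb)) some_onb"
      by (rule has_sum_bounded_linear[OF bounded_linear_cinner_right f])
    moreover have "((\<lambda>g. cinner e (?f g)) has_sum cinner e x) some_onb"
    proof (rule has_sum_finite_neutralI[where B = "{e}"])
      show "cinner e (?f g) = 0" if "g \<in> some_onb - {e}" for g
        using orthonormal_some_onb e that by (auto simp: orthonormal_def cinner_scaleC_right)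
      show "cinner e x = (\<Sum>g\<in>{e}. cinner e (?f g))"
        using orthonormal_some_onb e by (auto simp: orthonormal_def cinner_scaleC_right)
    qed (use e in auto)
    ultimately show ?thesis
      by (auto simp: cinner_diff_right dest: has_sum_unique)
  qed
  then have "x - infsum ?f some_onb = 0"
    by (rule some_onb_total)
  then show ?thesis
    using f by simp
qed

lemma Parseval: "((\<lambda>e. cinner x e * cinner e y) has_sum cinner x y) some_onb"
  using has_sum_bounded_linear[OF bounded_linear_cinner_right[of x] onb_expansion[of y]]
  by (simp add: cinner_scaleC_right mult.commute)

lemma Parseval_norm: "((\<lambda>e. (cmod (cinner e x))\<^sup>2) has_sum (norm x)\<^sup>2) some_onb"
proof -
  have "cinner x e * cinner e x = complex_of_real ((cmod (cinner e x))\<^sup>2)" for e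
    by (simp only: cinner_commute[of x e] complex_norm_square mult.commute)
  then show ?thesis
    using has_sum_Re[OF Parseval[of x x]] by (simp add: cinner_self del: of_real_power)
qed

section \<open>Adjoints\<close>

lemma bounded_opsD: "A \<in> bounded_ops \<Longrightarrow> A (c *\<^sub>C x) = c *\<^sub>C A x"
  by (simp add: bounded_ops_def)

text \<open>The Riesz representation theorem: the values of the functional on an orthonormal basis are
  square summable, and they are the coefficients of the representing vector.\<close>

lemma Riesz_representation:
  fixes f :: "'a::chilbert_space \<Rightarrow> complex"
  assumes f: "bounded_linear f" and lin: "\<And>c x. f (c *\<^sub>C x) = c * f x"
  shows "\<exists>z. \<forall>x. f x = cinner z x"
proof -
  let ?E = "some_onb :: 'a set"
  obtain K where K: "\<And>x. norm (f x) \<le> norm x * K"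
    using bounded_linear.bounded[OF f] by blast
  have "(\<Sum>e\<in>F. (cmod (cnj (f e)))\<^sup>2) \<le> K\<^sup>2" if F: "F \<subseteq> ?E" "finite F" for F
  proof -
    let ?s = "\<Sum>e\<in>F. cnj (f e) *\<^sub>C e"
    have s: "(norm ?s)\<^sup>2 = (\<Sum>e\<in>F. (cmod (cnj (f e)))\<^sup>2)"
      using orthonormal_norm_sum[OF orthonormal_some_onb F] .
    have "f ?s = (\<Sum>e\<in>F. f e * cnj (f e))"
      by (simp add: linear_sum[OF bounded_linear.linear[OF f]] lin mult.commute)
    also have "\<dots> = complex_of_real ((norm ?s)\<^sup>2)"
      by (simp only: s of_real_sum complex_norm_square complex_cnj_cnj mult.commute)
    finally have "(norm ?s)\<^sup>2 \<le> norm ?s * K"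
      using K[of ?s] by (simp add: norm_power)
    then have "norm ?s \<le> K \<or> norm ?s = 0"
      by (auto simp: power2_eq_square)
    then have "(norm ?s)\<^sup>2 \<le> K\<^sup>2"
      by (auto simp: power_mono)
    then show ?thesis
      using s by simp
  qed
  then have "(\<lambda>e. (cmod (cnj (f e)))\<^sup>2) summable_on ?E"
    by (intro nonneg_bdd_above_summable_on bdd_aboveI2) auto
  then have z: "((\<lambda>e. cnj (f e) *\<^sub>C e) has_sum (\<Sum>\<^sub>\<infinity>e\<in>?E. cnj (f e) *\<^sub>C e)) ?E" (is "(_ has_sum ?z) _")
    by (intro has_sum_infsum orthonormal_series_summable[OF orthonormal_some_onb])
  have "f x = cinner ?z x" for x
  proof (rule has_sum_unique)
    show "((\<lambda>e. f e * cinner e x) has_sum f x) ?E"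
      using has_sum_bounded_linear[OF f onb_expansion[of x]] by (simp add: lin mult.commute)
    show "((\<lambda>e. f e * cinner e x) has_sum cinner ?z x) ?E"
      using has_sum_bounded_linear[OF bounded_linear_cinner_left[of x] z]
      by (simp add: cinner_scaleC_left)
  qed
  then show ?thesis by blast
qed

lemma adjoint_exists:
  fixes A :: "'a::chilbert_space operator"
  assumes A: "A \<in> bounded_ops"
  shows "\<exists>B. B \<in> bounded_ops \<and> (\<forall>x y. cinner (B x) y = cinner x (A y))"
proof -
  have "\<exists>z. \<forall>y. cinner x (A y) = cinner z y" for x
  proof (rule Riesz_representation)
    show "bounded_linear (\<lambda>y. cinner x (A y))"
      by (rule bounded_linear_compose[OF bounded_linear_cinner_right blinfun.bounded_linear_right])
  qed (simp add: bounded_opsD[OF A] cinner_scaleC_right)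
  then obtain B where B: "\<And>x y. cinner (B x) y = cinner x (A y)"
    by metis
  have lin: "B (c *\<^sub>C x) = c *\<^sub>C B x" for c x
    by (rule cinner_ext_left) (simp add: B cinner_scaleC_left)
  have "bounded_linear B"
  proof (rule bounded_linear_intro[where K = "norm A"])
    show "B (x + y) = B x + B y" for x y
      by (rule cinner_ext_left) (simp add: B cinner_add_left)
    show "B (r *\<^sub>R x) = r *\<^sub>R B x" for r x
      by (simp add: scaleC_of_real[symmetric] lin)
    fix x
    have "cmod (cinner (B x) (B x)) \<le> norm x * norm (A (B x))"
      unfolding B by (rule cinner_Cauchy_Schwarz)
    also have "\<dots> \<le> norm x * (norm A * norm (B x))"
      by (intro mult_left_mono norm_blinfun) simp
    finally have "norm (B x) * norm (B x) \<le> (norm x * norm A) * norm (B x)"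
      by (simp add: cinner_self power2_eq_square norm_mult mult_ac)
    then show "norm (B x) \<le> norm x * norm A"
      by (cases "B x = 0") auto
  qed
  then have "Blinfun B \<in> bounded_ops \<and> (\<forall>x y. cinner (Blinfun B x) y = cinner x (A y))"
    by (simp add: bounded_ops_def bounded_linear_Blinfun_apply lin B)
  then show ?thesis by blast
qed

lemma adjoint_unique:
  fixes B B' :: "'a::chilbert_space operator"
  assumes "\<And>x y. cinner (B x) y = cinner x (A y)" "\<And>x y. cinner (B' x) y = cinner x (A y)"
  shows "B = B'"
  by (rule blinfun_eqI, rule cinner_ext_left) (simp add: assms)

lemma adj_op_spec:
  assumes "A \<in> bounded_ops"
  shows "adj_op A \<in> bounded_ops \<and> (\<forall>x y. cinner (adj_op A x) y = cinner x (A y))"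
  unfolding adj_op_def
  by (rule theI') (use adjoint_exists[OF assms] adjoint_unique in blast)

lemma adj_op_bounded [simp, intro]: "A \<in> bounded_ops \<Longrightarrow> adj_op A \<in> bounded_ops"
  using adj_op_spec by blast

lemma cinner_adj_left: "A \<in> bounded_ops \<Longrightarrow> cinner (adj_op A x) y = cinner x (A y)"
  using adj_op_spec by blast

lemma cinner_adj_right: "A \<in> bounded_ops \<Longrightarrow> cinner x (adj_op A y) = cinner (A x) y"
  by (metis cinner_adj_left cinner_commute)

lemma adj_op_eqI:
  fixes A B :: "'a::chilbert_space operator"
  assumes "A \<in> bounded_ops" "\<And>x y. cinner (B x) y = cinner x (A y)"
  shows "adj_op A = B"
  by (rule adjoint_unique[of _ A]) (use assms cinner_adj_left in auto)

lemma adj_adj [simp]: "A \<in> bounded_ops \<Longrightarrow> adj_op (adj_op A) = A"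
  by (rule adj_op_eqI) (auto simp: cinner_adj_right)

lemma scaleC_op_apply [simp]: "scaleC_op c A x = c *\<^sub>C A x"
  by (simp add: scaleC_op.rep_eq)

lemma bounded_ops_id [simp]: "id_blinfun \<in> bounded_ops"
  and bounded_ops_zero [simp]: "0 \<in> bounded_ops"
  and bounded_ops_add [simp]: "A \<in> bounded_ops \<Longrightarrow> B \<in> bounded_ops \<Longrightarrow> A + B \<in> bounded_ops"
  and bounded_ops_diff [simp]: "A \<in> bounded_ops \<Longrightarrow> B \<in> bounded_ops \<Longrightarrow> A - B \<in> bounded_ops"
  and bounded_ops_scaleR [simp]: "A \<in> bounded_ops \<Longrightarrow> r *\<^sub>R A \<in> bounded_ops"
  and bounded_ops_scaleC [simp]: "A \<in> bounded_ops \<Longrightarrow> scaleC_op c A \<in> bounded_ops"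
  and bounded_ops_compose [simp]: "A \<in> bounded_ops \<Longrightarrow> B \<in> bounded_ops \<Longrightarrow> A o\<^sub>L B \<in> bounded_ops"
  for A B :: "'a::chilbert_space operator"
  by (simp_all add: bounded_ops_def blinfun.bilinear_simps scaleC_add_right scaleC_diff_right
      scaleC_of_real[symmetric] scaleC_scaleC mult.commute)

lemma adj_compose:
  "A \<in> bounded_ops \<Longrightarrow> B \<in> bounded_ops \<Longrightarrow> adj_op (A o\<^sub>L B) = adj_op B o\<^sub>L adj_op A"
  by (rule adj_op_eqI) (auto simp: cinner_adj_left)

lemma closed_bounded_ops: "closed (bounded_ops :: 'a::chilbert_space operator set)"
proof -
  have eq: "bounded_ops = (\<Inter>c. \<Inter>x. {A :: 'a operator. A (c *\<^sub>C x) = c *\<^sub>C A x})"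
    by (auto simp: bounded_ops_def)
  have cl: "closed {A :: 'a operator. A (c *\<^sub>C x) = c *\<^sub>C A x}" for c x
  proof (rule closed_Collect_eq)
    show "continuous_on UNIV (\<lambda>A :: 'a operator. A (c *\<^sub>C x))"
      by (rule linear_continuous_on[OF blinfun.bounded_linear_left])
    show "continuous_on UNIV (\<lambda>A :: 'a operator. c *\<^sub>C A x)"
      by (rule linear_continuous_on[OF
            bounded_linear_compose[OF bounded_linear_scaleC blinfun.bounded_linear_left]])
  qed
  show ?thesis
    unfolding eq by (intro closed_INT ballI cl)
qed

section \<open>Positive operators and their square roots\<close>

definition selfadjoint :: "'a::chilbert_space operator \<Rightarrow> bool" where
  "selfadjoint A \<longleftrightarrow> A \<in> bounded_ops \<and> (\<forall>x y. cinner (A x) y = cinner x (A y))"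

lemma positive_op_bounded [simp]: "positive_op T \<Longrightarrow> T \<in> bounded_ops"
  by (simp add: positive_op_def)

lemma positive_op_Re: "positive_op T \<Longrightarrow> 0 \<le> Re (cinner x (T x))"
  and positive_op_of_real: "positive_op T \<Longrightarrow> cinner x (T x) = complex_of_real (Re (cinner x (T x)))"
  by (simp_all add: positive_op_def complex_nonneg_Reals_iff complex_eq_iff)

lemma positive_opI:
  assumes "T \<in> bounded_ops" "\<And>x. cinner x (T x) = complex_of_real (f x)" "\<And>x. 0 \<le> f x"
  shows "positive_op T"
  using assms by (simp add: positive_op_def)

lemma positive_op_add [simp]: "positive_op S \<Longrightarrow> positive_op T \<Longrightarrow> positive_op (S + T)"
  by (simp add: positive_op_def blinfun.add_left cinner_add_right complex_nonneg_Reals_iff)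

lemma positive_op_zero [simp]: "positive_op 0"
  by (simp add: positive_op_def)

lemma positive_op_selfadjoint:
  assumes T: "positive_op T"
  shows "cinner (T x) y = cinner x (T y)"
proof -
  have im: "Im (cinner z (T z)) = 0" for z
    using T by (simp add: positive_op_def complex_nonneg_Reals_iff)
  have "Im (cinner x (T y)) + Im (cinner y (T x)) = 0"
    using im[of "x + y"] im[of x] im[of y] by (simp add: blinfun.add_right cinner_bilinear)
  moreover have "Re (cinner x (T y)) - Re (cinner y (T x)) = 0"
    using im[of "x + \<i> *\<^sub>C y"] im[of x] im[of y] positive_op_bounded[OF T]
    by (simp add: blinfun.add_right cinner_bilinear bounded_opsD)
  ultimately have "cinner y (T x) = cnj (cinner x (T y))"
    by (simp add: complex_eq_iff)
  then show ?thesis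
    using cinner_commute[of "T x" y] by simp
qed

lemma positive_op_adj [simp]: "positive_op T \<Longrightarrow> adj_op T = T"
  by (rule adj_op_eqI) (auto simp: positive_op_selfadjoint)

lemma positive_op_square:
  assumes "selfadjoint R"
  shows "positive_op (R o\<^sub>L R)"
proof (rule positive_opI)
  show "cinner x ((R o\<^sub>L R) x) = complex_of_real ((norm (R x))\<^sup>2)" for x
    using assms unfolding cinner_self[symmetric] by (simp add: selfadjoint_def)
qed (use assms in \<open>simp_all add: selfadjoint_def\<close>)

lemma positive_op_Cauchy_Schwarz:
  assumes T: "positive_op T"
  shows "(cmod (cinner x (T y)))\<^sup>2 \<le> Re (cinner x (T x)) * Re (cinner y (T y))"
proof (rule quadratic_discriminant)
  fix c
  have yx: "cinner y (T x) = cnj (cinner x (T y))"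
    using positive_op_selfadjoint[OF T, of x y] cinner_commute[of y "T x"] by simp
  have "cinner (x + c *\<^sub>C y) (T (x + c *\<^sub>C y))
      = cinner x (T x) + (c * cinner x (T y) + cnj (c * cinner x (T y)))
        + (cnj c * c) * cinner y (T y)"
    using positive_op_bounded[OF T]
    by (simp add: blinfun.add_right cinner_bilinear bounded_opsD yx algebra_simps)
  also have "\<dots> = complex_of_real (Re (cinner x (T x)) + 2 * Re (c * cinner x (T y))
      + (cmod c)\<^sup>2 * Re (cinner y (T y)))"
    by (subst (1 2) positive_op_of_real[OF T])
      (simp only: complex_add_cnj cnj_mult_self of_real_mult of_real_add)
  finally show "0 \<le> Re (cinner x (T x)) + 2 * Re (c * cinner x (T y))
      + (cmod c)\<^sup>2 * Re (cinner y (T y))"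
    using positive_op_Re[OF T, of "x + c *\<^sub>C y"] by (simp only: Re_complex_of_real)
qed (rule positive_op_Re[OF T])

lemma positive_op_null:
  assumes T: "positive_op T" and "Re (cinner x (T x)) = 0"
  shows "T x = 0"
  using positive_op_Cauchy_Schwarz[OF T, of "T x" x] assms(2)
  by simp

text \<open>For a self-adjoint contraction \<open>S\<close>, a square root of \<open>1 - S\<close> is \<open>1 - Y\<close> where \<open>Y = (S + Y\<^sup>2) / 2\<close>, and \<open>Y\<close> is
  reached by iterating this equation.\<close>

primrec sqrt_iter :: "'a::chilbert_space operator \<Rightarrow> nat \<Rightarrow> 'a operator" where
  "sqrt_iter S 0 = 0"
| "sqrt_iter S (Suc n) = (1/2) *\<^sub>R (S + (sqrt_iter S n o\<^sub>L sqrt_iter S n))"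

text \<open>The same iteration for the number 1. It dominates the increments of the operator iteration,
  which gives convergence in norm.\<close>

primrec sqrt_iter_real :: "nat \<Rightarrow> real" where
  "sqrt_iter_real 0 = 0"
| "sqrt_iter_real (Suc n) = (1 + (sqrt_iter_real n)\<^sup>2) / 2"

lemma sqrt_iter_real_bounds: "0 \<le> sqrt_iter_real n \<and> sqrt_iter_real n \<le> 1"
  by (induction n) (auto simp: power_le_one)

lemma sqrt_iter_real_mono: "sqrt_iter_real n \<le> sqrt_iter_real (Suc n)"
  using zero_le_power2[of "sqrt_iter_real n - 1"] by (simp add: power2_diff)

lemma sqrt_iter_real_convergent: "convergent sqrt_iter_real"
  by (rule Bseq_mono_convergent)
    (use sqrt_iter_real_bounds sqrt_iter_real_mono in \<open>auto intro!: BseqI'[of _ 1] simp: lift_Suc_mono_le\<close>)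

lemma sqrt_iter_norm: "norm S \<le> 1 \<Longrightarrow> norm (sqrt_iter S n) \<le> sqrt_iter_real n"
proof (induction n)
  case (Suc n)
  have "norm (sqrt_iter S n o\<^sub>L sqrt_iter S n) \<le> norm (sqrt_iter S n) * norm (sqrt_iter S n)"
    by (rule norm_blinfun_compose)
  also have "\<dots> \<le> (sqrt_iter_real n)\<^sup>2"
    unfolding power2_eq_square using Suc sqrt_iter_real_bounds by (intro mult_mono) auto
  finally show ?case
    using norm_triangle_ineq[of S "sqrt_iter S n o\<^sub>L sqrt_iter S n"] \<open>norm S \<le> 1\<close> by simp
qed simp

text \<open>By the splitting \<open>Y\<^sup>2 - X\<^sup>2 = Y (Y - X) + (Y - X) X\<close>, each increment is controlled by the previous
  one, with the same recursion as for numbers.\<close>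

lemma sqrt_iter_increment:
  assumes S: "norm S \<le> 1"
  shows "norm (sqrt_iter S (Suc n) - sqrt_iter S n) \<le> sqrt_iter_real (Suc n) - sqrt_iter_real n"
proof (induction n)
  case 0
  then show ?case using S by simp
next
  case (Suc n)
  let ?X = "sqrt_iter S n" and ?Y = "sqrt_iter S (Suc n)"
  let ?x = "sqrt_iter_real n" and ?y = "sqrt_iter_real (Suc n)"
  have "sqrt_iter S (Suc (Suc n)) - ?Y = (1/2) *\<^sub>R ((?Y o\<^sub>L (?Y - ?X)) + ((?Y - ?X) o\<^sub>L ?X))"
  proof (rule blinfun_eqI)
    fix z
    have "sqrt_iter S (Suc (Suc n)) z - ?Y z = (1/2) *\<^sub>R (S z + ?Y (?Y z)) - (1/2) *\<^sub>R (S z + ?X (?X z))"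
      by (simp only: sqrt_iter.simps(2)[of S "Suc n"])
        (simp add: blinfun.bilinear_simps)
    then show "(sqrt_iter S (Suc (Suc n)) - ?Y) z
        = ((1/2) *\<^sub>R ((?Y o\<^sub>L (?Y - ?X)) + ((?Y - ?X) o\<^sub>L ?X))) z"
      by (simp add: blinfun.diff_left blinfun.diff_right blinfun.add_left blinfun.scaleR_left
          scaleR_right_diff_distrib[symmetric] del: sqrt_iter.simps)
  qed
  then have "norm (sqrt_iter S (Suc (Suc n)) - ?Y)
      \<le> (norm (?Y o\<^sub>L (?Y - ?X)) + norm ((?Y - ?X) o\<^sub>L ?X)) / 2"
    using norm_triangle_ineq[of "?Y o\<^sub>L (?Y - ?X)" "(?Y - ?X) o\<^sub>L ?X"] by simp
  also have "\<dots> \<le> (norm ?Y * norm (?Y - ?X) + norm (?Y - ?X) * norm ?X) / 2"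
    by (intro divide_right_mono add_mono norm_blinfun_compose) simp
  also have "\<dots> \<le> (?y * (?y - ?x) + (?y - ?x) * ?x) / 2"
    using Suc sqrt_iter_norm[OF S, of n] sqrt_iter_norm[OF S, of "Suc n"] sqrt_iter_real_bounds[of "Suc n"]
      sqrt_iter_real_mono[of n]
    by (intro divide_right_mono add_mono mult_mono) (auto simp del: sqrt_iter.simps sqrt_iter_real.simps)
  also have "\<dots> = sqrt_iter_real (Suc (Suc n)) - ?y"
    by (simp only: sqrt_iter_real.simps(2)[of "Suc n"] sqrt_iter_real.simps(2)[of n])
      (simp add: field_simps power2_eq_square)
  finally show ?case .
qed

lemma sqrt_iter_convergent:
  assumes "norm S \<le> 1"
  shows "convergent (sqrt_iter S)"
proof -
  have "summable (\<lambda>n. sqrt_iter_real (Suc n) - sqrt_iter_real n)"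
    using sqrt_iter_real_convergent telescope_summable unfolding convergent_def by blast
  then have "summable (\<lambda>n. sqrt_iter S (Suc n) - sqrt_iter S n)"
    by (rule summable_comparison_test'[where N = 0]) (use sqrt_iter_increment[OF assms] in blast)
  from summable_LIMSEQ[OF this] show ?thesis
    unfolding sum_lessThan_telescope by (auto simp: convergent_def)
qed

lemma selfadjoint_sqrt_iter:
  assumes "selfadjoint S"
  shows "selfadjoint (sqrt_iter S n)"
  using assms
  by (induction n)
    (auto simp: selfadjoint_def blinfun.bilinear_simps cinner_scaleR_left cinner_scaleR_right
      cinner_add_left cinner_add_right)

lemma sqrt_iter_commute:
  assumes "B o\<^sub>L S = S o\<^sub>L B"
  shows "B o\<^sub>L sqrt_iter S n = sqrt_iter S n o\<^sub>L B"
proof (induction n)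
  case (Suc n)
  have S: "B (S z) = S (B z)" and Y: "B (sqrt_iter S n z) = sqrt_iter S n (B z)" for z
    using assms Suc by (metis blinfun_apply_blinfun_compose)+
  show ?case
    by (rule blinfun_eqI) (simp add: blinfun.bilinear_simps S Y)
qed (rule blinfun_eqI, simp)

text \<open>As a norm limit of polynomials in \<open>S\<close>, the root commutes with everything that commutes with
  \<open>S\<close>.\<close>

lemma sqrt_of_id_minus_contraction:
  assumes S: "selfadjoint S" and le: "norm S \<le> 1"
  shows "\<exists>R. positive_op R \<and> R o\<^sub>L R = id_blinfun - S \<and>
    (\<forall>B. B o\<^sub>L S = S o\<^sub>L B \<longrightarrow> B o\<^sub>L R = R o\<^sub>L B)"
proof -
  obtain Y where lim: "sqrt_iter S \<longlonglongrightarrow> Y"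
    using sqrt_iter_convergent[OF le] convergent_def by blast
  note appl = bounded_linear.tendsto[OF blinfun.bounded_linear_left lim]
  have sa: "selfadjoint (sqrt_iter S n)" for n
    by (rule selfadjoint_sqrt_iter[OF S])
  have bd: "Y \<in> bounded_ops"
    by (rule closed_sequentially[OF closed_bounded_ops _ lim]) (use sa in \<open>simp add: selfadjoint_def\<close>)
  have sym: "cinner (Y x) y = cinner x (Y y)" for x y
  proof (rule LIMSEQ_unique)
    show "(\<lambda>n. cinner (sqrt_iter S n x) y) \<longlonglongrightarrow> cinner (Y x) y"
      by (rule bounded_linear.tendsto[OF bounded_linear_cinner_left appl])
    show "(\<lambda>n. cinner (sqrt_iter S n x) y) \<longlonglongrightarrow> cinner x (Y y)"
      using bounded_linear.tendsto[OF bounded_linear_cinner_right appl[of y], of x] sa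
      by (simp add: selfadjoint_def)
  qed
  have fixpoint: "Y = (1/2) *\<^sub>R (S + (Y o\<^sub>L Y))"
  proof (rule LIMSEQ_unique)
    show "(\<lambda>n. sqrt_iter S (Suc n)) \<longlonglongrightarrow> Y"
      using lim by (rule LIMSEQ_Suc)
    show "(\<lambda>n. sqrt_iter S (Suc n)) \<longlonglongrightarrow> (1/2) *\<^sub>R (S + (Y o\<^sub>L Y))"
      unfolding sqrt_iter.simps
      by (intro tendsto_intros bounded_bilinear.tendsto[OF bounded_bilinear_blinfun_compose] lim)
  qed
  have "norm (sqrt_iter S n) \<le> 1" for n
    using sqrt_iter_norm[OF le, of n] sqrt_iter_real_bounds[of n] by simp
  then have normY: "norm Y \<le> 1"
    using LIMSEQ_le_const2[OF tendsto_norm[OF lim]] by blast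
  let ?R = "id_blinfun - Y"
  have "positive_op ?R"
  proof (rule positive_opI[where f = "\<lambda>x. (norm x)\<^sup>2 - Re (cinner x (Y x))"])
    fix x
    have "cnj (cinner x (Y x)) = cinner x (Y x)"
      using sym[of x x] cinner_commute[of "Y x" x] by simp
    then have "Im (cinner x (Y x)) = 0"
      by (simp add: complex_eq_iff)
    then show "cinner x (?R x) = complex_of_real ((norm x)\<^sup>2 - Re (cinner x (Y x)))"
      by (simp add: blinfun.diff_left cinner_diff_right cinner_self complex_eq_iff)
    have "Re (cinner x (Y x)) \<le> norm x * norm (Y x)"
      using complex_Re_le_cmod[of "cinner x (Y x)"] cinner_Cauchy_Schwarz[of x "Y x"] by simp
    also have "\<dots> \<le> norm x * (1 * norm x)"
      using norm_blinfun[of Y x] mult_right_mono[OF normY, of "norm x"] by (intro mult_left_mono) auto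
    finally show "0 \<le> (norm x)\<^sup>2 - Re (cinner x (Y x))"
      by (simp add: power2_eq_square)
  qed (use bd in simp)
  moreover have "?R o\<^sub>L ?R = id_blinfun - S"
  proof (rule blinfun_eqI)
    fix x
    have "2 *\<^sub>R Y x = S x + Y (Y x)"
      using arg_cong[OF fixpoint, of "\<lambda>A. 2 *\<^sub>R A x"]
      by (simp add: blinfun.bilinear_simps del: scaleR_cancel_left)
    then show "(?R o\<^sub>L ?R) x = (id_blinfun - S) x"
      by (simp add: blinfun.bilinear_simps scaleR_2 algebra_simps)
  qed
  moreover have "B o\<^sub>L ?R = ?R o\<^sub>L B" if B: "B o\<^sub>L S = S o\<^sub>L B" for B
  proof -
    have "B o\<^sub>L Y = Y o\<^sub>L B"
    proof (rule LIMSEQ_unique)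
      show "(\<lambda>n. B o\<^sub>L sqrt_iter S n) \<longlonglongrightarrow> (B o\<^sub>L Y)"
        by (intro bounded_bilinear.tendsto[OF bounded_bilinear_blinfun_compose] lim tendsto_const)
      show "(\<lambda>n. B o\<^sub>L sqrt_iter S n) \<longlonglongrightarrow> (Y o\<^sub>L B)"
        unfolding sqrt_iter_commute[OF B]
        by (intro bounded_bilinear.tendsto[OF bounded_bilinear_blinfun_compose] lim tendsto_const)
    qed
    then have "B (Y z) = Y (B z)" for z
      by (metis blinfun_apply_blinfun_compose)
    then show ?thesis
      by (intro blinfun_eqI) (simp add: blinfun.bilinear_simps)
  qed
  ultimately show ?thesis by blast
qed

text \<open>Dividing by the norm reduces to \<open>T = 1 - S\<close> with \<open>0 \<le> S \<le> 1\<close>, and the Cauchy--Schwarz inequality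
  for \<open>S\<close> gives \<open>norm S \<le> 1\<close>. The clause on commuting operators serves to prove uniqueness.\<close>

lemma positive_sqrt_exists:
  assumes T: "positive_op T"
  shows "\<exists>R. positive_op R \<and> R o\<^sub>L R = T \<and> (\<forall>B. B o\<^sub>L T = T o\<^sub>L B \<longrightarrow> B o\<^sub>L R = R o\<^sub>L B)"
proof (cases "T = 0")
  case True
  then show ?thesis
    by (intro exI[of _ 0]) (auto intro: blinfun_eqI)
next
  case False
  define k where "k = norm T"
  have k: "k > 0" using False by (simp add: k_def)
  define S where "S = id_blinfun - (1/k) *\<^sub>R T"
  have S_apply: "S x = x - (1/k) *\<^sub>R T x" for x
    by (simp add: S_def blinfun.bilinear_simps)
  have le: "Re (cinner x (T x)) \<le> k * (norm x)\<^sup>2" for x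
  proof -
    have "Re (cinner x (T x)) \<le> norm x * norm (T x)"
      using complex_Re_le_cmod[of "cinner x (T x)"] cinner_Cauchy_Schwarz[of x "T x"] by simp
    also have "\<dots> \<le> norm x * (k * norm x)"
      unfolding k_def by (intro mult_left_mono norm_blinfun) simp
    finally show ?thesis
      by (simp add: power2_eq_square mult_ac)
  qed
  have posS: "positive_op S"
  proof (rule positive_opI[where f = "\<lambda>x. (norm x)\<^sup>2 - Re (cinner x (T x)) / k"])
    show "S \<in> bounded_ops"
      using T by (simp add: S_def)
    fix x
    show "cinner x (S x) = complex_of_real ((norm x)\<^sup>2 - Re (cinner x (T x)) / k)"
      unfolding S_apply cinner_diff_right cinner_scaleR_right
      by (subst positive_op_of_real[OF T]) (simp add: cinner_self)
    show "0 \<le> (norm x)\<^sup>2 - Re (cinner x (T x)) / k"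
      using le[of x] k by (simp add: field_simps)
  qed
  have "norm (S x) \<le> 1 * norm x" for x
  proof -
    have ReS: "Re (cinner y (S y)) \<le> (norm y)\<^sup>2" for y
      unfolding S_apply cinner_diff_right cinner_scaleR_right
      using positive_op_Re[OF T, of y] k by (simp add: cinner_self)
    have "((norm (S x))\<^sup>2)\<^sup>2 = (cmod (cinner (S x) (S x)))\<^sup>2"
      by (simp add: cinner_self norm_power)
    also have "\<dots> \<le> Re (cinner (S x) (S (S x))) * Re (cinner x (S x))"
      by (rule positive_op_Cauchy_Schwarz[OF posS])
    also have "\<dots> \<le> (norm (S x))\<^sup>2 * (norm x)\<^sup>2"
      by (intro mult_mono ReS positive_op_Re[OF posS]) simp
    finally have "(norm (S x))\<^sup>2 * (norm (S x))\<^sup>2 \<le> (norm (S x))\<^sup>2 * (norm x)\<^sup>2"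
      by (simp only: power2_eq_square)
    then have "norm (S x) = 0 \<or> (norm (S x))\<^sup>2 \<le> (norm x)\<^sup>2"
      by (metis mult_le_cancel_left_pos zero_less_power2)
    then show ?thesis
      by (metis mult_1 norm_ge_zero power2_le_imp_le)
  qed
  then have "norm S \<le> 1"
    by (intro norm_blinfun_bound) auto
  moreover have "selfadjoint S"
    using posS by (simp add: selfadjoint_def positive_op_selfadjoint)
  ultimately obtain R where R: "positive_op R" "R o\<^sub>L R = id_blinfun - S"
    and comm: "\<And>B. B o\<^sub>L S = S o\<^sub>L B \<Longrightarrow> B o\<^sub>L R = R o\<^sub>L B"
    using sqrt_of_id_minus_contraction by blast
  let ?R = "sqrt k *\<^sub>R R"
  have "positive_op ?R"
  proof (rule positive_opI[where f = "\<lambda>x. sqrt k * Re (cinner x (R x))"])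
    show "cinner x (?R x) = complex_of_real (sqrt k * Re (cinner x (R x)))" for x
      unfolding blinfun.scaleR_left cinner_scaleR_right
      by (subst positive_op_of_real[OF R(1)]) simp
  qed (use R positive_op_Re[OF R(1)] k in auto)
  moreover have "?R o\<^sub>L ?R = T"
  proof (rule blinfun_eqI)
    fix x
    have "R (R x) = (1/k) *\<^sub>R T x"
      using arg_cong[OF R(2), of "\<lambda>A. A x"] by (simp add: S_def blinfun.bilinear_simps)
    then show "(?R o\<^sub>L ?R) x = T x"
      using k by (simp add: blinfun.bilinear_simps)
  qed
  moreover have "B o\<^sub>L ?R = ?R o\<^sub>L B" if B: "B o\<^sub>L T = T o\<^sub>L B" for B
  proof -
    have "B (T z) = T (B z)" for z
      using B by (metis blinfun_apply_blinfun_compose)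
    then have "B o\<^sub>L S = S o\<^sub>L B"
      by (intro blinfun_eqI) (simp add: S_apply blinfun.bilinear_simps)
    then have "B (R z) = R (B z)" for z
      using comm by (metis blinfun_apply_blinfun_compose)
    then show ?thesis
      by (intro blinfun_eqI) (simp add: blinfun.bilinear_simps)
  qed
  ultimately show ?thesis by blast
qed

text \<open>If \<open>S\<close> is the square root of \<open>P\<^sup>2\<close> constructed above, then \<open>P\<close> and \<open>S\<close> commute, so
  \<open>(P + S) (P - S) = 0\<close>. Both summands being positive, they vanish on the range of \<open>P - S\<close>,
  whence \<open>(P - S)\<^sup>2 = 0\<close>.\<close>

lemma positive_sqrt_unique:
  assumes P: "positive_op P" and Q: "positive_op Q" and eq: "P o\<^sub>L P = Q o\<^sub>L Q"
  shows "P = Q"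
proof -
  have "selfadjoint P"
    using P by (simp add: selfadjoint_def positive_op_selfadjoint)
  then obtain S where S: "positive_op S" "S o\<^sub>L S = P o\<^sub>L P"
    and comm: "\<And>B. B o\<^sub>L (P o\<^sub>L P) = (P o\<^sub>L P) o\<^sub>L B \<Longrightarrow> B o\<^sub>L S = S o\<^sub>L B"
    using positive_sqrt_exists[OF positive_op_square] by blast
  have "X = S" if X: "positive_op X" "X o\<^sub>L X = P o\<^sub>L P" for X
  proof (rule blinfun_eqI)
    fix x
    have "X o\<^sub>L S = S o\<^sub>L X"
      by (rule comm) (rule blinfun_eqI, simp add: X(2)[symmetric])
    then have XS: "X (S z) = S (X z)" for z
      by (metis blinfun_apply_blinfun_compose)
    have XX: "X (X z) = S (S z)" for z
      using X(2) S(2) by (metis blinfun_apply_blinfun_compose)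
    define y where "y = X x - S x"
    have "X y + S y = 0"
      by (simp add: y_def blinfun.diff_right XS XX)
    then have "Re (cinner y (X y)) + Re (cinner y (S y)) = 0"
      by (metis cinner_add_right cinner_zero_right plus_complex.simps(1) zero_complex.simps(1))
    then have "X y = 0" "S y = 0"
      using positive_op_Re[OF X(1), of y] positive_op_Re[OF S(1), of y]
      by (auto intro!: positive_op_null X S)
    then have "cinner y y = 0"
      using positive_op_selfadjoint[OF X(1), of x y] positive_op_selfadjoint[OF S(1), of x y]
      by (subst (1) y_def) (simp add: cinner_diff_left)
    then show "X x = S x"
      by (simp add: y_def)
  qed
  then show ?thesis
    using P Q eq by metis
qed

lemma abs_op_eqI:
  assumes "positive_op P" "P o\<^sub>L P = adj_op T o\<^sub>L T"
  shows "abs_op T = P"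
  unfolding abs_op_def by (rule the_equality) (use assms in \<open>auto intro: positive_sqrt_unique\<close>)

lemma abs_op_positive [simp]: "positive_op T \<Longrightarrow> abs_op T = T"
  by (rule abs_op_eqI) auto

section \<open>Rank-one operators\<close>

lift_definition ketbra :: "'a::chilbert_space \<Rightarrow> 'a \<Rightarrow> 'a operator" is "\<lambda>x y z. cinner y z *\<^sub>C x"
proof (rule bounded_linear_intro)
  fix x y z z' :: 'a and r :: real
  show "cinner y (z + z') *\<^sub>C x = cinner y z *\<^sub>C x + cinner y z' *\<^sub>C x"
    by (simp add: cinner_add_right scaleC_add_left)
  show "cinner y (r *\<^sub>R z) *\<^sub>C x = r *\<^sub>R cinner y z *\<^sub>C x"
    by (simp add: cinner_scaleC_right scaleC_of_real[symmetric] scaleC_scaleC)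
  show "norm (cinner y z *\<^sub>C x) \<le> norm z * (norm y * norm x)"
    using mult_right_mono[OF cinner_Cauchy_Schwarz[of y z], of "norm x"]
    by (simp add: norm_scaleC mult_ac)
qed

lemma ketbra_apply [simp]: "ketbra x y z = cinner y z *\<^sub>C x"
  by (simp add: ketbra.rep_eq)

lemma ketbra_bounded [simp]: "ketbra x y \<in> bounded_ops"
  by (simp add: bounded_ops_def cinner_scaleC_right scaleC_scaleC)

lemma ketbra_add_left: "ketbra (x + x') y = ketbra x y + ketbra x' y"
  and ketbra_add_right: "ketbra x (y + y') = ketbra x y + ketbra x y'"
  and ketbra_scaleC_left: "ketbra (c *\<^sub>C x) y = scaleC_op c (ketbra x y)"
  and ketbra_scaleC_right: "ketbra x (c *\<^sub>C y) = scaleC_op (cnj c) (ketbra x y)"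
  by (rule blinfun_eqI; simp add: blinfun.add_left cinner_bilinear scaleC_add_left
      scaleC_add_right scaleC_scaleC mult.commute)+

lemma adj_ketbra: "adj_op (ketbra x y) = ketbra y x"
  by (rule adj_op_eqI) (simp_all add: cinner_scaleC_left cinner_scaleC_right cinner_commute[symmetric] mult.commute)

lemma ketbra_self_diag: "cinner z (ketbra x x z) = complex_of_real ((cmod (cinner x z))\<^sup>2)"
  by (simp only: ketbra_apply cinner_scaleC_right cinner_commute[of z x] complex_norm_square)

lemma positive_ketbra [simp]: "positive_op (ketbra x x)"
  by (rule positive_opI[OF _ ketbra_self_diag]) auto

text \<open>For \<open>y = 0\<close> both sides vanish, by the convention for division by zero.\<close>

lemma abs_ketbra: "abs_op (ketbra x y) = (norm x / norm y) *\<^sub>R ketbra y y"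
proof -
  define k where "k = norm x / norm y"
  have kk: "cinner x x = complex_of_real k * complex_of_real k * cinner y y" if "y \<noteq> 0"
    using that by (simp add: k_def cinner_self power2_eq_square)
  have "abs_op (ketbra x y) = k *\<^sub>R ketbra y y"
  proof (rule abs_op_eqI)
    show "positive_op (k *\<^sub>R ketbra y y)"
    proof (rule positive_opI)
      show "cinner z ((k *\<^sub>R ketbra y y) z) = complex_of_real (k * (cmod (cinner y z))\<^sup>2)" for z
        by (simp only: blinfun.scaleR_left cinner_scaleR_right ketbra_self_diag of_real_mult)
    qed (simp_all add: k_def)
    show "(k *\<^sub>R ketbra y y) o\<^sub>L (k *\<^sub>R ketbra y y) = adj_op (ketbra x y) o\<^sub>L ketbra x y"
    proof (rule blinfun_eqI)
      show "((k *\<^sub>R ketbra y y) o\<^sub>L (k *\<^sub>R ketbra y y)) z = (adj_op (ketbra x y) o\<^sub>L ketbra x y) z" for z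
        by (cases "y = 0")
          (simp_all add: adj_ketbra blinfun.scaleR_left blinfun.scaleR_right cinner_scaleC_right
            scaleC_of_real[symmetric] scaleC_scaleC kk mult_ac)
    qed
  qed
  then show ?thesis
    by (simp add: k_def)
qed


section \<open>Traces\<close>

lemma trace_class_positive_iff:
  assumes T: "positive_op T"
  shows "T \<in> trace_class \<longleftrightarrow> (\<lambda>e. Re (cinner e (T e))) summable_on some_onb"
proof -
  have "(\<lambda>e. cinner e (T e)) = (\<lambda>e. complex_of_real (Re (cinner e (T e))))"
    using positive_op_of_real[OF T] by blast
  then have "(\<lambda>e. cinner e (T e)) summable_on some_onb \<longleftrightarrow> (\<lambda>e. Re (cinner e (T e))) summable_on some_onb"
    using summable_on_Re[of "\<lambda>e. cinner e (T e)" some_onb]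
      summable_on_of_real[of "\<lambda>e. Re (cinner e (T e))" some_onb] by metis
  then show ?thesis
    using T by (simp add: trace_class_def)
qed

lemma trace_has_sum:
  assumes "positive_op T" "T \<in> trace_class"
  shows "((\<lambda>e. cinner e (T e)) has_sum op_trace T) some_onb"
  unfolding op_trace_def using assms by (intro has_sum_infsum) (simp add: trace_class_def)

lemma trace_has_sum_Re:
  assumes "positive_op T" "T \<in> trace_class"
  shows "((\<lambda>e. Re (cinner e (T e))) has_sum Re (op_trace T)) some_onb"
  by (rule has_sum_Re[OF trace_has_sum[OF assms]])

lemma trace_class_dominated:
  assumes "positive_op S" "positive_op T" "T \<in> trace_class"
    and "\<And>x. Re (cinner x (S x)) \<le> Re (cinner x (T x))"
  shows "S \<in> trace_class"
  using assms summable_on_comparison_test[of "\<lambda>e. Re (cinner e (T e))" some_onb "\<lambda>e. Re (cinner e (S e))"]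
  by (simp add: trace_class_positive_iff positive_op_Re)

lemma ketbra_trace_class [simp]: "ketbra x y \<in> trace_class"
proof -
  have "cinner e (abs_op (ketbra x y) e) = complex_of_real (norm x / norm y * (cmod (cinner e y))\<^sup>2)" for e
  proof -
    have "cmod (cinner e y) = cmod (cinner y e)"
      by (metis cinner_commute complex_mod_cnj)
    then show ?thesis
      by (simp only: abs_ketbra blinfun.scaleR_left cinner_scaleR_right ketbra_self_diag of_real_mult)
  qed
  then show ?thesis
    using summable_on_of_real[OF summable_on_cmult_right[OF Bessel_summable[OF orthonormal_some_onb]]]
    by (simp only: trace_class_def mem_Collect_eq ketbra_bounded simp_thms)
qed

lemma trace_ketbra_has_sum:
  assumes "A \<in> bounded_ops"
  shows "((\<lambda>e. cinner e (ketbra x y (A e))) has_sum cinner y (A x)) some_onb"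
  using Parseval[of "adj_op A y" x] assms
  by (simp add: cinner_scaleC_right cinner_adj_left)

lemma trace_ketbra_compose: "A \<in> bounded_ops \<Longrightarrow> op_trace (ketbra x y o\<^sub>L A) = cinner y (A x)"
  unfolding op_trace_def using infsumI[OF trace_ketbra_has_sum[of A x y]] by simp

lemma trace_ketbra: "op_trace (ketbra x y) = cinner y x"
  using infsumI[OF trace_ketbra_has_sum[of id_blinfun x y]] by (simp add: op_trace_def)

definition hilbert_schmidt :: "'a::chilbert_space operator \<Rightarrow> bool" where
  "hilbert_schmidt B \<longleftrightarrow> B \<in> bounded_ops \<and> (\<lambda>e. (norm (B e))\<^sup>2) summable_on some_onb"

lemma cmod_cinner_adj: "B \<in> bounded_ops \<Longrightarrow> cmod (cinner g (B e)) = cmod (cinner e (adj_op B g))"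
  by (metis cinner_adj_left cinner_commute complex_mod_cnj)

lemma hilbert_schmidt_matrix:
  assumes "hilbert_schmidt B"
  shows "(\<lambda>(e, g). (cmod (cinner g (B e)))\<^sup>2) summable_on some_onb \<times> some_onb"
  by (rule summable_on_SigmaI[where g = "\<lambda>e. (norm (B e))\<^sup>2"])
    (use assms Parseval_norm in \<open>auto simp: hilbert_schmidt_def\<close>)

text \<open>The squared matrix entries of \<open>B\<close> are summed by rows instead of by columns.\<close>

lemma hilbert_schmidt_adj:
  assumes B: "hilbert_schmidt B"
  shows "hilbert_schmidt (adj_op B)"
proof -
  let ?E = "some_onb :: 'a set"
  have b: "B \<in> bounded_ops"
    using B by (simp add: hilbert_schmidt_def)
  obtain s where "((\<lambda>(e, g). (cmod (cinner g (B e)))\<^sup>2) has_sum s) (?E \<times> ?E)"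
    using hilbert_schmidt_matrix[OF B] by (auto simp: summable_on_def)
  then have "((\<lambda>(g, e). (cmod (cinner g (B e)))\<^sup>2) has_sum s) (?E \<times> ?E)"
    by (subst (asm) has_sum_swap) (simp add: case_prod_unfold)
  then have "((\<lambda>g. (norm (adj_op B g))\<^sup>2) has_sum s) ?E"
    by (rule has_sum_SigmaD) (simp add: cmod_cinner_adj[OF b] Parseval_norm)
  then show ?thesis
    using b by (auto simp: hilbert_schmidt_def summable_on_def)
qed

text \<open>Both series are the sum of the double series with entries \<open>\<langle>B e, g\<rangle> \<langle>g, C e\<rangle>\<close>. All
  statements about traces of products rest on this.\<close>

lemma hilbert_schmidt_pairing:
  assumes B: "hilbert_schmidt B" and C: "hilbert_schmidt C"
  shows "\<exists>s. ((\<lambda>e. cinner (B e) (C e)) has_sum s) some_onb \<and>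
    ((\<lambda>e. cinner (adj_op C e) (adj_op B e)) has_sum s) some_onb"
proof -
  let ?E = "some_onb :: 'a set"
  let ?f = "\<lambda>(e, g). cinner (B e) g * cinner g (C e)"
  have b: "B \<in> bounded_ops" "C \<in> bounded_ops"
    using B C by (simp_all add: hilbert_schmidt_def)
  have "?f summable_on (?E \<times> ?E)"
  proof (rule Infinite_Sum.abs_summable_summable, rule Infinite_Sum.abs_summable_on_comparison_test')
    show "(\<lambda>p. (case p of (e, g) \<Rightarrow> (cmod (cinner g (B e)))\<^sup>2) + (case p of (e, g) \<Rightarrow> (cmod (cinner g (C e)))\<^sup>2))
        summable_on (?E \<times> ?E)"
      by (intro summable_on_add hilbert_schmidt_matrix B C)
    fix p :: "'a \<times> 'a"
    obtain e g where p: "p = (e, g)" by force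
    have "cmod (cinner (B e) g) = cmod (cinner g (B e))"
      by (metis cinner_commute complex_mod_cnj)
    moreover have "u * v \<le> u\<^sup>2 + v\<^sup>2" if "0 \<le> u" "0 \<le> v" for u v :: real
      using sum_squares_bound[of u v] mult_nonneg_nonneg[OF that] by linarith
    ultimately show "norm (?f p) \<le> (case p of (e, g) \<Rightarrow> (cmod (cinner g (B e)))\<^sup>2) + (case p of (e, g) \<Rightarrow> (cmod (cinner g (C e)))\<^sup>2)"
      by (simp add: p norm_mult)
  qed
  then obtain s where s: "(?f has_sum s) (?E \<times> ?E)"
    by (auto simp: summable_on_def)
  have "((\<lambda>e. cinner (B e) (C e)) has_sum s) ?E"
    using s by (rule has_sum_SigmaD) (simp add: Parseval)
  moreover have "((\<lambda>(g, e). cinner (adj_op C g) e * cinner e (adj_op B g)) has_sum s) (?E \<times> ?E)"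
    using s b by (subst (asm) has_sum_swap)
      (simp add: case_prod_unfold cinner_adj_left cinner_adj_right mult.commute)
  then have "((\<lambda>g. cinner (adj_op C g) (adj_op B g)) has_sum s) ?E"
    by (rule has_sum_SigmaD) (simp add: Parseval)
  ultimately show ?thesis by blast
qed

lemma hilbert_schmidt_sqrt:
  assumes T: "positive_op T" "T \<in> trace_class"
  obtains R where "positive_op R" "R o\<^sub>L R = T" "hilbert_schmidt R"
    "((\<lambda>e. (norm (R e))\<^sup>2) has_sum Re (op_trace T)) some_onb"
proof -
  obtain R where R: "positive_op R" "R o\<^sub>L R = T"
    using positive_sqrt_exists[OF T(1)] by blast
  have "cinner e (T e) = cinner (R e) (R e)" for e
    using positive_op_selfadjoint[OF R(1), of e "R e"] R(2) by auto
  then have "Re (cinner e (T e)) = (norm (R e))\<^sup>2" for e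
    by (simp add: cinner_self)
  then have sum: "((\<lambda>e. (norm (R e))\<^sup>2) has_sum Re (op_trace T)) some_onb"
    using trace_has_sum_Re[OF T] by simp
  then have "hilbert_schmidt R"
    using R by (auto simp: hilbert_schmidt_def summable_on_def)
  then show thesis
    using that R sum by blast
qed

lemma hilbert_schmidt_compose_left:
  assumes B: "hilbert_schmidt B" and A: "A \<in> bounded_ops"
  shows "hilbert_schmidt (A o\<^sub>L B)"
proof -
  have "(\<lambda>e. (norm A)\<^sup>2 * (norm (B e))\<^sup>2) summable_on some_onb"
    using B by (intro summable_on_cmult_right) (simp add: hilbert_schmidt_def)
  then have "(\<lambda>e. (norm (A (B e)))\<^sup>2) summable_on some_onb"
    by (rule summable_on_comparison_test)
      (auto simp: power_mult_distrib[symmetric] intro!: power_mono norm_blinfun)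
  then show ?thesis
    using A B by (simp add: hilbert_schmidt_def)
qed

lemma hilbert_schmidt_compose_right:
  assumes B: "hilbert_schmidt B" and A: "A \<in> bounded_ops"
  shows "hilbert_schmidt (B o\<^sub>L A)"
proof -
  have b: "B \<in> bounded_ops"
    using B by (simp add: hilbert_schmidt_def)
  have "hilbert_schmidt (adj_op (adj_op A o\<^sub>L adj_op B))"
    using A B by (intro hilbert_schmidt_adj hilbert_schmidt_compose_left) auto
  then show ?thesis
    using A b by (simp add: adj_compose)
qed

text \<open>For \<open>T = R\<^sup>2\<close> the traces of \<open>T A\<close> and of \<open>A T\<close> both equal the manifestly absolutely
  convergent trace of \<open>R A R\<close>.\<close>

lemma trace_product_has_sum:
  assumes R: "positive_op R" "hilbert_schmidt R" and A: "A \<in> bounded_ops"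
  shows "((\<lambda>e. cinner (R e) (A (R e))) has_sum op_trace ((R o\<^sub>L R) o\<^sub>L A)) some_onb"
    and "((\<lambda>e. cinner e (R (R (A e)))) has_sum op_trace ((R o\<^sub>L R) o\<^sub>L A)) some_onb"
    and "((\<lambda>e. cinner e (A (R (R e)))) has_sum op_trace ((R o\<^sub>L R) o\<^sub>L A)) some_onb"
proof -
  let ?E = "some_onb :: 'a set"
  have b [simp]: "R \<in> bounded_ops" "A \<in> bounded_ops" using R A by auto
  note sa = positive_op_selfadjoint[OF R(1)]
  obtain s where s: "((\<lambda>e. cinner (R e) (R (A e))) has_sum s) ?E"
      "((\<lambda>e. cinner (R e) (A (R e))) has_sum s) ?E"
    using hilbert_schmidt_pairing[OF R(2) hilbert_schmidt_compose_right[OF R(2) A]] R(1)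
    by (auto simp: adj_compose cinner_adj_left)
  obtain s' where s': "((\<lambda>e. cinner (R (adj_op A e)) (R e)) has_sum s') ?E"
      "((\<lambda>e. cinner (R e) (A (R e))) has_sum s') ?E"
    using hilbert_schmidt_pairing[OF hilbert_schmidt_compose_right[OF R(2) adj_op_bounded[OF A]] R(2)] R(1)
    by (auto simp: adj_compose)
  have [simp]: "s' = s"
    using s(2) s'(2) has_sum_unique by blast
  have 1: "((\<lambda>e. cinner e (R (R (A e)))) has_sum s) ?E"
    using s(1) by (simp add: sa)
  then have tr: "op_trace ((R o\<^sub>L R) o\<^sub>L A) = s"
    by (simp add: op_trace_def infsumI)
  show "((\<lambda>e. cinner (R e) (A (R e))) has_sum op_trace ((R o\<^sub>L R) o\<^sub>L A)) ?E"
    "((\<lambda>e. cinner e (R (R (A e)))) has_sum op_trace ((R o\<^sub>L R) o\<^sub>L A)) ?E"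
    using tr 1 s(2) by simp_all
  show "((\<lambda>e. cinner e (A (R (R e)))) has_sum op_trace ((R o\<^sub>L R) o\<^sub>L A)) ?E"
    using tr s'(1) by (simp add: sa cinner_adj_left)
qed

text \<open>The span of the positive trace class operators: traces against bounded operators converge and
  are cyclic on it, because these properties are linear in \<open>T\<close> and hold for positive \<open>T\<close>.\<close>

inductive_set trace_span :: "'a::chilbert_space operator set" where
  positive: "positive_op T \<Longrightarrow> T \<in> trace_class \<Longrightarrow> T \<in> trace_span"
| add: "S \<in> trace_span \<Longrightarrow> T \<in> trace_span \<Longrightarrow> S + T \<in> trace_span"
| scaleC: "T \<in> trace_span \<Longrightarrow> scaleC_op c T \<in> trace_span"

lemma trace_span_cyclic:
  assumes "T \<in> trace_span" and A: "A \<in> bounded_ops"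
  shows "\<exists>s. ((\<lambda>e. cinner e (T (A e))) has_sum s) some_onb \<and>
    ((\<lambda>e. cinner e (A (T e))) has_sum s) some_onb"
  using assms(1)
proof induction
  case (positive T)
  then obtain R where "positive_op R" "R o\<^sub>L R = T" "hilbert_schmidt R"
    by (rule hilbert_schmidt_sqrt)
  then show ?case
    using trace_product_has_sum(2,3)[of R A] A by auto
next
  case (add S T)
  then obtain s t where
    "((\<lambda>e. cinner e (S (A e))) has_sum s) some_onb" "((\<lambda>e. cinner e (A (S e))) has_sum s) some_onb"
    "((\<lambda>e. cinner e (T (A e))) has_sum t) some_onb" "((\<lambda>e. cinner e (A (T e))) has_sum t) some_onb"
    by blast
  then show ?case
    by (intro exI[of _ "s + t"])
      (simp add: blinfun.add_left blinfun.add_right cinner_add_right has_sum_add)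
next
  case (scaleC T c)
  then obtain s where
    "((\<lambda>e. cinner e (T (A e))) has_sum s) some_onb" "((\<lambda>e. cinner e (A (T e))) has_sum s) some_onb"
    by blast
  then show ?case
    using A by (intro exI[of _ "c * s"])
      (simp add: cinner_scaleC_right bounded_opsD has_sum_cmult_right)
qed

lemma trace_span_has_sum:
  assumes "T \<in> trace_span" "A \<in> bounded_ops"
  shows "((\<lambda>e. cinner e (T (A e))) has_sum op_trace (T o\<^sub>L A)) some_onb"
    and "((\<lambda>e. cinner e (A (T e))) has_sum op_trace (T o\<^sub>L A)) some_onb"
  using trace_span_cyclic[OF assms] infsumI by (fastforce simp: op_trace_def)+

lemma trace_commute:
  assumes "T \<in> trace_span" "A \<in> bounded_ops"
  shows "op_trace (A o\<^sub>L T) = op_trace (T o\<^sub>L A)"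
  using infsumI[OF trace_span_has_sum(2)[OF assms]] by (simp add: op_trace_def)

lemma trace_compose_add_left:
  assumes "S \<in> trace_span" "T \<in> trace_span" "A \<in> bounded_ops"
  shows "op_trace ((S + T) o\<^sub>L A) = op_trace (S o\<^sub>L A) + op_trace (T o\<^sub>L A)"
  using infsumI[OF has_sum_add[OF trace_span_has_sum(1)[OF assms(1,3)] trace_span_has_sum(1)[OF assms(2,3)]]]
  by (simp add: op_trace_def[of "(S + T) o\<^sub>L A"] blinfun.add_left cinner_add_right)

lemma trace_compose_scaleC_left: "op_trace (scaleC_op c T o\<^sub>L A) = c * op_trace (T o\<^sub>L A)"
  by (simp add: op_trace_def cinner_scaleC_right infsum_cmult_right')

lemma trace_adj:
  assumes T: "positive_op T" "T \<in> trace_class" and A: "A \<in> bounded_ops"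
  shows "op_trace (T o\<^sub>L adj_op A) = cnj (op_trace (T o\<^sub>L A))"
proof -
  have "((\<lambda>e. cnj (cinner e (A (T e)))) has_sum cnj (op_trace (T o\<^sub>L A))) some_onb"
    using trace_span_has_sum(2)[OF trace_span.positive[OF T] A] by simp
  moreover have "cnj (cinner e (A (T e))) = cinner e (T (adj_op A e))" for e
    using A T(1) by (metis cinner_adj_right cinner_commute positive_op_selfadjoint)
  ultimately show ?thesis
    by (simp add: op_trace_def infsumI)
qed

text \<open>With \<open>T = R\<^sup>2\<close>, the traces of \<open>A T A\<^sup>*\<close> and of \<open>T A\<^sup>* A\<close> both equal the sum of the
  \<open>\<parallel>A R e\<parallel>\<^sup>2\<close>.\<close>

lemma trace_conjugation:
  assumes T: "positive_op T" "T \<in> trace_class" and A: "A \<in> bounded_ops"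
  shows "((\<lambda>e. cinner (adj_op A e) (T (adj_op A e))) has_sum op_trace (T o\<^sub>L (adj_op A o\<^sub>L A))) some_onb"
proof -
  obtain R where R: "positive_op R" "R o\<^sub>L R = T" "hilbert_schmidt R"
    using hilbert_schmidt_sqrt[OF T] .
  have hs: "hilbert_schmidt (R o\<^sub>L adj_op A)"
    using A by (intro hilbert_schmidt_compose_right[OF R(3)]) auto
  have "((\<lambda>e. cinner (R (adj_op A e)) (R (adj_op A e))) has_sum op_trace (T o\<^sub>L (adj_op A o\<^sub>L A))) some_onb"
    using hilbert_schmidt_pairing[OF hs hs] A R(1) trace_product_has_sum(1)[OF R(1,3), of "adj_op A o\<^sub>L A"]
    by (auto simp: adj_compose cinner_adj_right R(2) dest: has_sum_unique)
  moreover have "cinner (R x) (R x) = cinner x (T x)" for x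
    using R(2) positive_op_selfadjoint[OF R(1)] by auto
  ultimately show ?thesis
    by simp
qed

lemma trace_norm_bound:
  assumes T: "positive_op T" "T \<in> trace_class" and A: "A \<in> bounded_ops"
  shows "cmod (op_trace (T o\<^sub>L A)) \<le> norm A * Re (op_trace T)"
proof -
  obtain R where R: "positive_op R" "R o\<^sub>L R = T" "hilbert_schmidt R"
      "((\<lambda>e. (norm (R e))\<^sup>2) has_sum Re (op_trace T)) some_onb"
    using hilbert_schmidt_sqrt[OF T] .
  have sum: "((\<lambda>e. norm A * (norm (R e))\<^sup>2) has_sum norm A * Re (op_trace T)) some_onb"
    by (rule has_sum_cmult_right[OF R(4)])
  have "norm (op_trace (T o\<^sub>L A)) \<le> norm A * Re (op_trace T)"
  proof (rule norm_infsum_le[OF _ sum])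
    show "((\<lambda>e. cinner (R e) (A (R e))) has_sum op_trace (T o\<^sub>L A)) some_onb"
      using trace_product_has_sum(1)[OF R(1,3) A] R(2) by simp
    show "norm (cinner (R e) (A (R e))) \<le> norm A * (norm (R e))\<^sup>2" for e
      using cinner_Cauchy_Schwarz[of "R e" "A (R e)"]
        mult_left_mono[OF norm_blinfun[of A "R e"], of "norm (R e)"]
      by (simp add: power2_eq_square mult_ac)
  qed
  then show ?thesis by simp
qed

text \<open>This bounds \<open>\<langle>x, \<Phi>(|z\<rangle>\<langle>z|) x\<rangle>\<close> by \<open>\<parallel>x\<parallel>\<^sup>2 \<parallel>z\<parallel>\<^sup>2\<close> and thereby makes the operators
  \<open>kraus u v\<close> below bounded.\<close>

lemma quadratic_form_le_trace:
  assumes T: "positive_op T" "T \<in> trace_class"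
  shows "Re (cinner x (T x)) \<le> (norm x)\<^sup>2 * Re (op_trace T)"
proof -
  obtain R where R: "positive_op R" "R o\<^sub>L R = T"
      "((\<lambda>e. (norm (R e))\<^sup>2) has_sum Re (op_trace T)) some_onb"
    using hilbert_schmidt_sqrt[OF T] by metis
  have "cinner x (T x) = cinner (R x) (R x)"
    using positive_op_selfadjoint[OF R(1), of x "R x"] R(2) by auto
  then have "Re (cinner x (T x)) = (norm (R x))\<^sup>2"
    by (simp add: cinner_self)
  also have "\<dots> \<le> (norm x)\<^sup>2 * Re (op_trace T)"
  proof (rule has_sum_mono[OF Parseval_norm has_sum_cmult_right[OF R(3)]])
    fix e
    have "cmod (cinner e (R x)) \<le> norm (R e) * norm x"
      unfolding positive_op_selfadjoint[OF R(1), symmetric] by (rule cinner_Cauchy_Schwarz)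
    then show "(cmod (cinner e (R x)))\<^sup>2 \<le> (norm x)\<^sup>2 * (norm (R e))\<^sup>2"
      by (simp add: power_mult_distrib[symmetric] mult.commute power_mono)
  qed
  finally show ?thesis .
qed

section \<open>Quantum operations on rank-one operators\<close>

text \<open>Polarization expresses \<open>\<Phi>(|x\<rangle>\<langle>y|)\<close> by values of \<open>\<Phi>\<close> on positive operators.\<close>

lemma polarization:
  fixes G :: "'a::chilbert_space \<Rightarrow> 'a \<Rightarrow> 'a operator"
  assumes add: "\<And>x x' y. G (x + x') y = G x y + G x' y" "\<And>x y y'. G x (y + y') = G x y + G x y'"
    and scale: "\<And>c x y. G (c *\<^sub>C x) y = scaleC_op c (G x y)" "\<And>c x y. G x (c *\<^sub>C y) = scaleC_op (cnj c) (G x y)"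
  shows "G x y = scaleC_op (1/4) (G (x + y) (x + y) + scaleC_op (-1) (G (x + (-1) *\<^sub>C y) (x + (-1) *\<^sub>C y))
    + scaleC_op \<i> (G (x + \<i> *\<^sub>C y) (x + \<i> *\<^sub>C y))
    + scaleC_op (-\<i>) (G (x + (-\<i>) *\<^sub>C y) (x + (-\<i>) *\<^sub>C y)))" (is "_ = ?rhs")
proof (rule blinfun_eqI)
  fix z
  let ?b = "G x y z"
  have "?rhs z = (1/4) *\<^sub>C (?b + ?b + ?b + ?b)"
    unfolding add scale scaleC_op_apply blinfun.add_left
    by (rule arg_cong[where f = "(*\<^sub>C) (1/4)"])
      (simp add: scaleC_add_right scaleC_diff_right scaleC_minus_right scaleC_minus_left
        scaleC_scaleC algebra_simps)
  also have "\<dots> = (1/4 + 1/4 + 1/4 + 1/4) *\<^sub>C ?b"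
    by (simp only: scaleC_add_left scaleC_add_right)
  finally show "G x y z = ?rhs z"
    by simp
qed

text \<open>A sesquilinear form with vanishing diagonal is zero.\<close>

lemma sesquilinear_diagonal_zero:
  fixes D :: "'a::chilbert_space \<Rightarrow> 'a \<Rightarrow> complex"
  assumes add: "\<And>x x' y. D (x + x') y = D x y + D x' y" "\<And>x y y'. D x (y + y') = D x y + D x y'"
    and scale: "\<And>c x y. D (c *\<^sub>C x) y = c * D x y" "\<And>c x y. D x (c *\<^sub>C y) = cnj c * D x y"
    and diag: "\<And>x. D x x = 0"
  shows "D x y = 0"
proof -
  have "D x y + D y x = 0"
    using diag[of "x + y"] unfolding add by (simp add: diag add.commute)
  moreover have "- \<i> * D x y + \<i> * D y x = 0"
    using diag[of "x + \<i> *\<^sub>C y"] unfolding add scale by (simp add: diag)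
  then have "\<i> * (D y x - D x y) = 0"
    by (simp add: algebra_simps)
  ultimately show ?thesis
    by simp
qed

context
  fixes \<Phi> :: "'a::chilbert_space operator \<Rightarrow> 'a operator"
  assumes qo: "quantum_operation \<Phi>"
begin

lemma
  shows qo_trace_class: "T \<in> trace_class \<Longrightarrow> \<Phi> T \<in> trace_class"
    and qo_add: "S \<in> trace_class \<Longrightarrow> T \<in> trace_class \<Longrightarrow> \<Phi> (S + T) = \<Phi> S + \<Phi> T"
    and qo_scaleC: "T \<in> trace_class \<Longrightarrow> \<Phi> (scaleC_op c T) = scaleC_op c (\<Phi> T)"
    and qo_trace: "T \<in> trace_class \<Longrightarrow> op_trace (\<Phi> T) = op_trace T"
    and qo_completely_positive: "completely_positive \<Phi>"
  using qo by (simp_all add: quantum_operation_def)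

lemma qo_positive:
  assumes "positive_op T" "T \<in> trace_class"
  shows "positive_op (\<Phi> T)"
proof -
  have "positive_block 1 (\<lambda>i j. T)"
    using assms(1) by (simp add: positive_block_def positive_op_def)
  then have "positive_block 1 (\<lambda>i j. \<Phi> T)"
    using qo_completely_positive assms(2)
    unfolding completely_positive_def by (elim allE[of _ 1] allE[of _ "\<lambda>i j. T"]) auto
  then show ?thesis
    by (auto simp: positive_block_def positive_op_def dest: spec[of _ "\<lambda>_::nat. _"])
qed

lemma qo_zero: "\<Phi> 0 = 0"
proof -
  have "\<Phi> (scaleC_op 0 (ketbra 0 0)) = scaleC_op 0 (\<Phi> (ketbra 0 0))"
    by (rule qo_scaleC) simp
  moreover have "scaleC_op 0 T = 0" for T :: "'a operator"
    by (rule blinfun_eqI) simp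
  ultimately show ?thesis by simp
qed

lemma qo_ketbra_sesquilinear:
  "\<Phi> (ketbra (x + x') y) = \<Phi> (ketbra x y) + \<Phi> (ketbra x' y)"
  "\<Phi> (ketbra x (y + y')) = \<Phi> (ketbra x y) + \<Phi> (ketbra x y')"
  "\<Phi> (ketbra (c *\<^sub>C x) y) = scaleC_op c (\<Phi> (ketbra x y))"
  "\<Phi> (ketbra x (c *\<^sub>C y)) = scaleC_op (cnj c) (\<Phi> (ketbra x y))"
  by (simp_all add: ketbra_add_left ketbra_add_right ketbra_scaleC_left ketbra_scaleC_right
      qo_add qo_scaleC)

lemma qo_ketbra_in_trace_span: "\<Phi> (ketbra x y) \<in> trace_span"
proof -
  have "\<Phi> (ketbra z z) \<in> trace_span" for z
    by (simp add: trace_span.positive qo_positive qo_trace_class)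
  then show ?thesis
    by (subst polarization[where G = "\<lambda>x y. \<Phi> (ketbra x y)", OF qo_ketbra_sesquilinear])
      (intro trace_span.add trace_span.scaleC)
qed

lemma qo_ketbra_bounded [simp]: "\<Phi> (ketbra x y) \<in> bounded_ops"
  using qo_trace_class[OF ketbra_trace_class] unfolding trace_class_def by blast

lemma qo_ketbra_self:
  "positive_op (\<Phi> (ketbra x x))" "\<Phi> (ketbra x x) \<in> trace_class"
  "op_trace (\<Phi> (ketbra x x)) = complex_of_real ((norm x)\<^sup>2)"
  by (simp_all add: qo_positive qo_trace_class qo_trace trace_ketbra cinner_self)

text \<open>Complete positivity on the matrices \<open>|z\<^sub>i\<rangle>\<langle>z\<^sub>j|\<close> says that
  \<open>\<langle>w, \<Phi>(|z\<rangle>\<langle>z'|) w'\<rangle>\<close> is a positive semidefinite kernel in the pairs \<open>(w, z)\<close>.\<close>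

definition qo_kernel :: "'a \<times> 'a \<Rightarrow> 'a \<times> 'a \<Rightarrow> complex" where
  "qo_kernel p q = cinner (fst p) (\<Phi> (ketbra (snd p) (snd q)) (fst q))"

lemma qo_kernel_positive:
  fixes p :: "nat \<Rightarrow> 'a \<times> 'a"
  shows "(\<Sum>i<n. \<Sum>j<n. qo_kernel (p i) (p j)) \<in> \<real>\<^sub>\<ge>\<^sub>0"
proof -
  let ?T = "\<lambda>i j. ketbra (snd (p i)) (snd (p j))"
  have "(\<Sum>i<n. \<Sum>j<n. cinner (x i) (?T i j (x j))) \<in> \<real>\<^sub>\<ge>\<^sub>0" for x
  proof -
    let ?s = "\<Sum>j<n. cinner (snd (p j)) (x j)"
    have "(\<Sum>i<n. \<Sum>j<n. cinner (x i) (?T i j (x j))) = (\<Sum>i<n. \<Sum>j<n. cnj (cinner (snd (p i)) (x i)) * cinner (snd (p j)) (x j))"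
      by (simp add: cinner_scaleC_right cinner_commute[symmetric] mult.commute)
    also have "\<dots> = cnj ?s * ?s"
      by (simp only: sum_product cnj_sum)
    also have "\<dots> = complex_of_real ((cmod ?s)\<^sup>2)"
      by (rule cnj_mult_self)
    finally show ?thesis
      by (simp del: of_real_power)
  qed
  then have "positive_block n ?T"
    by (simp add: positive_block_def)
  then have "positive_block n (\<lambda>i j. \<Phi> (?T i j))"
    using qo_completely_positive unfolding completely_positive_def by simp
  then show ?thesis
    unfolding positive_block_def qo_kernel_def by (elim conjE allE[of _ "\<lambda>i. fst (p i)"])
qed

lemma qo_kernel_scaleC_left: "qo_kernel (c *\<^sub>C w, z) q = cnj c * qo_kernel (w, z) q"
  and qo_kernel_scaleC_right: "qo_kernel q (c *\<^sub>C w, z) = c * qo_kernel q (w, z)"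
  and qo_kernel_minus_left: "qo_kernel (- w, z) q = - qo_kernel (w, z) q"
  and qo_kernel_minus_right: "qo_kernel q (- w, z) = - qo_kernel q (w, z)"
  and qo_kernel_zero_left: "qo_kernel (0, z) q = 0"
  and qo_kernel_zero_right: "qo_kernel q (0, z) = 0"
  by (simp_all add: qo_kernel_def cinner_bilinear bounded_opsD blinfun.minus_right)

lemma qo_kernel_hermitian: "qo_kernel q p = cnj (qo_kernel p q)"
proof -
  have pos: "qo_kernel a a + qo_kernel a b + (qo_kernel b a + qo_kernel b b) \<in> \<real>\<^sub>\<ge>\<^sub>0" for a b
    using qo_kernel_positive[of "\<lambda>i. if i = 0 then a else b" 2] by (simp add: numeral_2_eq_2)
  have im: "Im (qo_kernel a a) = 0" for a
    using pos[of a "(0, 0)"] by (simp add: qo_kernel_zero_left qo_kernel_zero_right complex_nonneg_Reals_iff)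
  obtain w z where q: "q = (w, z)" by force
  have "Im (qo_kernel p q) + Im (qo_kernel q p) = 0"
    using pos[of p q] im by (simp add: complex_nonneg_Reals_iff)
  moreover have "Re (qo_kernel p q) - Re (qo_kernel q p) = 0"
    using pos[of p "(\<i> *\<^sub>C w, z)"] im[of p] im[of "(\<i> *\<^sub>C w, z)"]
    by (simp add: q qo_kernel_scaleC_left qo_kernel_scaleC_right complex_nonneg_Reals_iff)
  ultimately show ?thesis
    by (simp add: complex_eq_iff)
qed

lemma qo_kernel_pair_positive:
  "qo_kernel p0 p0 + qo_kernel p0 p1 + qo_kernel p1 p0 + qo_kernel p1 p1 \<in> \<real>\<^sub>\<ge>\<^sub>0"
  using qo_kernel_positive[of "\<lambda>i. if i = 0 then p0 else p1" 2] by (simp add: numeral_2_eq_2 add_ac)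

lemma qo_kernel_self: "qo_kernel p p = complex_of_real (Re (qo_kernel p p))" "0 \<le> Re (qo_kernel p p)"
  using qo_kernel_positive[of "\<lambda>_. p" 1] by (simp_all add: complex_nonneg_Reals_iff complex_eq_iff)

text \<open>The Cauchy--Schwarz inequality between the combination \<open>p0 + p1\<close> of two kernel vectors and a
  third one.\<close>

lemma qo_kernel_Cauchy_Schwarz:
  "(cmod (qo_kernel p0 p2 + qo_kernel p1 p2))\<^sup>2
    \<le> Re (qo_kernel p0 p0 + qo_kernel p0 p1 + qo_kernel p1 p0 + qo_kernel p1 p1) * Re (qo_kernel p2 p2)"
proof (rule quadratic_discriminant)
  fix c
  obtain w z where p2: "p2 = (w, z)" by force
  let ?q = "(c *\<^sub>C w, z)"
  let ?b = "qo_kernel p0 p2 + qo_kernel p1 p2"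
  let ?a = "qo_kernel p0 p0 + qo_kernel p0 p1 + qo_kernel p1 p0 + qo_kernel p1 p1"
  have "qo_kernel ?q ?q = (cnj c * c) * qo_kernel p2 p2"
    by (simp add: p2 qo_kernel_scaleC_left qo_kernel_scaleC_right)
  also have "\<dots> = complex_of_real ((cmod c)\<^sup>2 * Re (qo_kernel p2 p2))"
    by (subst qo_kernel_self(1)) (simp only: cnj_mult_self of_real_mult)
  finally have qq: "Re (qo_kernel ?q ?q) = (cmod c)\<^sup>2 * Re (qo_kernel p2 p2)"
    by (simp only: Re_complex_of_real)
  have b: "qo_kernel p0 ?q + qo_kernel p1 ?q = c * ?b"
    by (simp add: p2 qo_kernel_scaleC_right distrib_left)
  have b': "qo_kernel ?q p0 + qo_kernel ?q p1 = cnj (c * ?b)"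
    using b by (metis qo_kernel_hermitian complex_cnj_add)
  \<comment> \<open>Scaling the vector part of the third entry by \<open>c\<close> produces the quadratic form in \<open>c\<close>.\<close>
  have "0 \<le> Re (\<Sum>i<3. \<Sum>j<3. qo_kernel ([p0, p1, ?q] ! i) ([p0, p1, ?q] ! j))"
    using qo_kernel_positive[where n = 3 and p = "\<lambda>i. [p0, p1, ?q] ! i"]
    by (simp only: complex_nonneg_Reals_iff)
  also have "(\<Sum>i<3. \<Sum>j<3. qo_kernel ([p0, p1, ?q] ! i) ([p0, p1, ?q] ! j))
      = ?a + (qo_kernel p0 ?q + qo_kernel p1 ?q) + (qo_kernel ?q p0 + qo_kernel ?q p1) + qo_kernel ?q ?q"
    by (simp add: numeral_3_eq_3 add_ac)
  also have "Re \<dots> = Re ?a + 2 * Re (c * ?b) + (cmod c)\<^sup>2 * Re (qo_kernel p2 p2)"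
    unfolding b b' by (simp only: plus_complex.simps complex_cnj qq cnj.simps)
  finally show "0 \<le> Re ?a + 2 * Re (c * ?b) + (cmod c)\<^sup>2 * Re (qo_kernel p2 p2)" .
qed (rule qo_kernel_self(2))


section \<open>Constants are tested on rank-one operators\<close>

lemma constant_diagonal:
  assumes A: "A \<in> constants \<Phi>"
  shows "op_trace (\<Phi> (ketbra x x) o\<^sub>L A) = cinner x (A x)"
proof (cases "x = 0")
  case True
  have "ketbra 0 0 = (0 :: 'a operator)"
    by (rule blinfun_eqI) simp
  then show ?thesis
    using True by (simp add: qo_zero op_trace_def)
next
  case False
  define u where "u = complex_of_real (1 / norm x) *\<^sub>C x"
  have x: "x = complex_of_real (norm x) *\<^sub>C u"
    using False by (simp add: u_def scaleC_scaleC)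
  have "norm u = 1"
    using False by (simp add: u_def norm_scaleC norm_divide)
  then have "ketbra u u \<in> states"
    by (simp add: states_def trace_ketbra cinner_self)
  then have "op_trace (\<Phi> (ketbra u u) o\<^sub>L A) = op_trace (ketbra u u o\<^sub>L A)" and "A \<in> bounded_ops"
    using A by (auto simp: constants_def)
  then have "op_trace (\<Phi> (ketbra u u) o\<^sub>L A) = cinner u (A u)"
    by (simp add: trace_ketbra_compose)
  then show ?thesis
    using \<open>A \<in> bounded_ops\<close>
    by (subst (1 2 3 4) x)
      (simp add: qo_ketbra_sesquilinear trace_compose_scaleC_left bounded_opsD cinner_scaleC_left cinner_scaleC_right)
qed

lemma constant_off_diagonal:
  assumes A: "A \<in> constants \<Phi>"
  shows "op_trace (\<Phi> (ketbra x y) o\<^sub>L A) = cinner y (A x)"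
proof -
  have b: "A \<in> bounded_ops"
    using A by (simp add: constants_def)
  have "op_trace (\<Phi> (ketbra x y) o\<^sub>L A) - cinner y (A x) = 0"
    by (rule sesquilinear_diagonal_zero[of "\<lambda>x y. op_trace (\<Phi> (ketbra x y) o\<^sub>L A) - cinner y (A x)"])
      (simp_all add: qo_ketbra_sesquilinear trace_compose_add_left qo_ketbra_in_trace_span b
        trace_compose_scaleC_left blinfun.add_right cinner_bilinear bounded_opsD[OF b] constant_diagonal[OF A]
        algebra_simps)
  then show ?thesis by simp
qed

text \<open>Write \<open>\<rho> = R\<^sup>2\<close>. The finite rank operators \<open>R P R\<close>, for the projections \<open>P\<close> onto the span
  of finite parts of an orthonormal basis, lie below \<open>\<rho>\<close> and their traces approach that of \<open>\<rho>\<close>.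
  On the positive remainder, \<open>\<Phi>\<close> preserves the trace, so both sides are small there.\<close>

lemma constantI:
  assumes A: "A \<in> bounded_ops" and diag: "\<And>x. op_trace (\<Phi> (ketbra x x) o\<^sub>L A) = cinner x (A x)"
  shows "A \<in> constants \<Phi>"
proof -
  have "op_trace (\<Phi> \<rho> o\<^sub>L A) = op_trace (\<rho> o\<^sub>L A)" if \<rho>: "positive_op \<rho>" "\<rho> \<in> trace_class" for \<rho>
  proof -
    define g where "g T = op_trace (\<Phi> T o\<^sub>L A) - op_trace (T o\<^sub>L A)" for T
    have g_add: "g (S + T) = g S + g T"
      if "positive_op S" "S \<in> trace_class" "positive_op T" "T \<in> trace_class" for S T
      using that A unfolding g_def
      by (simp add: qo_add trace_compose_add_left trace_span.positive qo_positive qo_trace_class)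
    have g_bound: "cmod (g T) \<le> 2 * norm A * Re (op_trace T)" if T: "positive_op T" "T \<in> trace_class" for T
      using trace_norm_bound[OF T A] trace_norm_bound[OF qo_positive[OF T] qo_trace_class[OF T(2)] A]
        norm_triangle_ineq4[of "op_trace (\<Phi> T o\<^sub>L A)" "op_trace (T o\<^sub>L A)"] qo_trace[OF T(2)]
      unfolding g_def by simp
    obtain R where R: "positive_op R" "R o\<^sub>L R = \<rho>"
        "((\<lambda>e. (norm (R e))\<^sup>2) has_sum Re (op_trace \<rho>)) some_onb"
      using hilbert_schmidt_sqrt[OF \<rho>] by metis
    define \<rho>F where "\<rho>F F = (\<Sum>e\<in>F. ketbra (R e) (R e))" for F
    have \<rho>F_pos: "positive_op (\<rho>F F)" if "finite F" for F
      using that unfolding \<rho>F_def by (induction F) auto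
    have \<rho>F_diag: "Re (cinner x (\<rho>F F x)) = (\<Sum>e\<in>F. (cmod (cinner e (R x)))\<^sup>2)" for F x
      unfolding \<rho>F_def blinfun.sum_left cinner_sum_right ketbra_self_diag
      by (simp add: positive_op_selfadjoint[OF R(1)])
    have \<rho>_diag: "Re (cinner x (\<rho> x)) = (norm (R x))\<^sup>2" for x
    proof -
      have "cinner x (\<rho> x) = cinner (R x) (R x)"
        using positive_op_selfadjoint[OF R(1), of x "R x"] R(2) by auto
      then show ?thesis
        by (simp add: cinner_self)
    qed
    have \<rho>F_le: "Re (cinner x (\<rho>F F x)) \<le> Re (cinner x (\<rho> x))" if "finite F" "F \<subseteq> some_onb" for F x
      unfolding \<rho>F_diag \<rho>_diag using that by (intro Bessel[OF orthonormal_some_onb])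
    have \<rho>F_tc: "\<rho>F F \<in> trace_class" if "finite F" "F \<subseteq> some_onb" for F
      by (rule trace_class_dominated[OF \<rho>F_pos \<rho>]) (use that \<rho>F_le in auto)
    have zero: "(0 :: 'a operator) \<in> trace_class"
      by (simp add: trace_class_positive_iff)
    have g_\<rho>F: "g (\<rho>F F) = 0" and tr_\<rho>F: "op_trace (\<rho>F F) = complex_of_real (\<Sum>e\<in>F. (norm (R e))\<^sup>2)"
      if "finite F" "F \<subseteq> some_onb" for F
    proof -
      have "g (\<rho>F F) = 0 \<and> op_trace (\<rho>F F) = complex_of_real (\<Sum>e\<in>F. (norm (R e))\<^sup>2)"
        using that
      proof (induction F)
        case empty
        then show ?case
          by (simp add: \<rho>F_def g_def qo_zero op_trace_def)
      next
        case (insert e F)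
        have eq: "\<rho>F (insert e F) = ketbra (R e) (R e) + \<rho>F F"
          using insert by (simp add: \<rho>F_def)
        have "g (ketbra (R e) (R e)) = 0"
          using diag A by (simp add: g_def trace_ketbra_compose)
        then have "g (\<rho>F (insert e F)) = 0"
          using insert \<rho>F_pos \<rho>F_tc by (simp add: eq g_add)
        moreover have "op_trace (ketbra (R e) (R e) + \<rho>F F) = op_trace (ketbra (R e) (R e)) + op_trace (\<rho>F F)"
          using trace_compose_add_left[of "ketbra (R e) (R e)" "\<rho>F F" id_blinfun] insert \<rho>F_pos \<rho>F_tc
          by (simp add: trace_span.positive op_trace_def)
        ultimately show ?case
          using insert by (simp add: eq trace_ketbra cinner_self)
      qed
      then show "g (\<rho>F F) = 0" "op_trace (\<rho>F F) = complex_of_real (\<Sum>e\<in>F. (norm (R e))\<^sup>2)"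
        by auto
    qed
    have estimate: "cmod (g \<rho>) \<le> 2 * norm A * (Re (op_trace \<rho>) - (\<Sum>e\<in>F. (norm (R e))\<^sup>2))"
      if F: "finite F" "F \<subseteq> some_onb" for F
    proof -
      have pos: "positive_op (\<rho> - \<rho>F F)"
      proof (rule positive_opI)
        show "\<rho> - \<rho>F F \<in> bounded_ops"
          using \<rho> \<rho>F_pos[OF F(1)] by simp
        show "cinner x ((\<rho> - \<rho>F F) x) = complex_of_real (Re (cinner x (\<rho> x)) - Re (cinner x (\<rho>F F x)))" for x
          using positive_op_of_real[OF \<rho>(1), of x] positive_op_of_real[OF \<rho>F_pos[OF F(1)], of x]
          by (simp add: blinfun.diff_left cinner_diff_right)
        show "0 \<le> Re (cinner x (\<rho> x)) - Re (cinner x (\<rho>F F x))" for x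
          using \<rho>F_le[OF F] by simp
      qed
      have tc: "\<rho> - \<rho>F F \<in> trace_class"
        by (rule trace_class_dominated[OF pos \<rho>])
          (use positive_op_Re[OF \<rho>F_pos[OF F(1)]] in \<open>simp add: blinfun.diff_left cinner_diff_right\<close>)
      have "op_trace \<rho> = op_trace (\<rho> - \<rho>F F) + op_trace (\<rho>F F)"
        using trace_compose_add_left[of "\<rho> - \<rho>F F" "\<rho>F F" id_blinfun] pos tc \<rho>F_pos \<rho>F_tc F
        by (simp add: trace_span.positive op_trace_def)
      moreover have "g \<rho> = g (\<rho> - \<rho>F F) + g (\<rho>F F)"
        using g_add[OF pos tc \<rho>F_pos \<rho>F_tc, of F] F by simp
      ultimately show ?thesis
        using g_bound[OF pos tc] by (simp add: g_\<rho>F[OF F] tr_\<rho>F[OF F])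
    qed
    have "((\<lambda>F. 2 * norm A * (Re (op_trace \<rho>) - (\<Sum>e\<in>F. (norm (R e))\<^sup>2)))
        \<longlongrightarrow> 2 * norm A * (Re (op_trace \<rho>) - Re (op_trace \<rho>))) (finite_subsets_at_top some_onb)"
      using R(3) unfolding has_sum_def by (intro tendsto_intros)
    then have "cmod (g \<rho>) \<le> 2 * norm A * (Re (op_trace \<rho>) - Re (op_trace \<rho>))"
      by (rule tendsto_lowerbound)
        (auto intro!: eventually_finite_subsets_at_top_weakI estimate)
    then show ?thesis
      by (simp add: g_def)
  qed
  then show ?thesis
    using A by (auto simp: constants_def states_def)
qed

lemma constants_adj:
  assumes "A \<in> constants \<Phi>"
  shows "adj_op A \<in> constants \<Phi>"
proof (rule constantI)
  have b: "A \<in> bounded_ops"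
    using assms by (simp add: constants_def)
  then show "adj_op A \<in> bounded_ops" by simp
  show "op_trace (\<Phi> (ketbra x x) o\<^sub>L adj_op A) = cinner x (adj_op A x)" for x
    using trace_adj[OF qo_ketbra_self(1,2) b, of x] constant_diagonal[OF assms, of x]
    by (metis b cinner_adj_right cinner_commute)
qed


section \<open>The Kraus operators and their commutant\<close>

text \<open>If \<open>\<Phi>(\<rho>) = \<Sum> K\<^sub>i \<rho> K\<^sub>i\<^sup>*\<close>, then \<open>x \<mapsto> \<Phi>(|x\<rangle>\<langle>u|) v\<close> is the linear combination
  \<open>\<Sum> \<langle>u, K\<^sub>i\<^sup>* v\<rangle> K\<^sub>i\<close> of the \<open>K\<^sub>i\<close>. These combinations make sense without a Kraus
  decomposition and can replace the \<open>K\<^sub>i\<close>.\<close>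

definition kraus :: "'a \<Rightarrow> 'a \<Rightarrow> 'a operator" where
  "kraus u v = Blinfun (\<lambda>x. \<Phi> (ketbra x u) v)"

lemma kraus_norm_bound: "norm (\<Phi> (ketbra x u) v) \<le> norm x * (norm u * norm v)"
proof -
  let ?k = "\<Phi> (ketbra x u) v"
  have "qo_kernel (?k, x) (v, u) = complex_of_real (norm ?k * norm ?k)"
    by (simp add: qo_kernel_def cinner_self power2_eq_square)
  then have "(norm ?k * norm ?k)\<^sup>2 = (cmod (qo_kernel (?k, x) (v, u)))\<^sup>2"
    by (simp only: norm_of_real) simp
  also have "\<dots> \<le> Re (qo_kernel (?k, x) (?k, x)) * Re (qo_kernel (v, u) (v, u))"
    using qo_kernel_Cauchy_Schwarz[of "(?k, x)" "(v, u)" "(0, 0)"]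
    by (simp add: qo_kernel_zero_left qo_kernel_zero_right)
  also have "\<dots> \<le> ((norm ?k)\<^sup>2 * (norm x)\<^sup>2) * ((norm v)\<^sup>2 * (norm u)\<^sup>2)"
    using quadratic_form_le_trace[OF qo_ketbra_self(1,2), of ?k x]
      quadratic_form_le_trace[OF qo_ketbra_self(1,2), of v u] qo_kernel_self(2)
    by (intro mult_mono) (auto simp: qo_kernel_def qo_ketbra_self(3) simp del: of_real_power)
  finally have "(norm ?k * norm ?k)\<^sup>2 \<le> (norm ?k * (norm x * (norm u * norm v)))\<^sup>2"
    by (simp only: power_mult_distrib mult_ac)
  then have "norm ?k * norm ?k \<le> norm ?k * (norm x * (norm u * norm v))"
    by (rule power2_le_imp_le) simp
  then show ?thesis
    by (cases "?k = 0") auto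
qed

lemma kraus_apply [simp]: "kraus u v x = \<Phi> (ketbra x u) v"
proof -
  have "bounded_linear (\<lambda>x. \<Phi> (ketbra x u) v)"
  proof (rule bounded_linear_intro[OF _ _ kraus_norm_bound])
    show "\<Phi> (ketbra (r *\<^sub>R x) u) v = r *\<^sub>R \<Phi> (ketbra x u) v" for r x
      by (simp add: scaleC_of_real[symmetric] qo_ketbra_sesquilinear)
  qed (simp add: qo_ketbra_sesquilinear blinfun.add_left)
  then show ?thesis
    by (simp add: kraus_def bounded_linear_Blinfun_apply)
qed

lemma kraus_bounded [simp]: "kraus u v \<in> bounded_ops"
  by (simp add: bounded_ops_def qo_ketbra_sesquilinear)

text \<open>In terms of Kraus operators, the four traces below add up to
  \<open>\<Sum> \<parallel>(K\<^sub>i A - A K\<^sub>i) x\<parallel>\<^sup>2\<close>, and they cancel because \<open>A\<close>, its adjoint and \<open>A\<^sup>* A\<close> are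
  constants.\<close>

lemma kraus_commute:
  assumes A: "A \<in> constants \<Phi>" and AA: "adj_op A o\<^sub>L A \<in> constants \<Phi>"
  shows "A o\<^sub>L kraus u v = kraus u v o\<^sub>L A"
proof (rule blinfun_eqI)
  fix x
  let ?E = "some_onb :: 'a set"
  have b [simp]: "A \<in> bounded_ops"
    using A by (simp add: constants_def)
  define n where "n = complex_of_real ((norm (A x))\<^sup>2)"
  have n: "cinner (A x) (A x) = n"
    by (simp only: n_def cinner_self)
  \<comment> \<open>In terms of Kraus operators, the pair \<open>p e\<close>, \<open>q e\<close> has
    \<open>\<langle>- A\<^sup>* e, K x\<rangle> + \<langle>e, K (A x)\<rangle> = \<langle>e, (K A - A K) x\<rangle>\<close>.\<close>
  define p where "p e = (- adj_op A e, x)" for e :: 'a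
  define q where "q e = (e, A x)" for e :: 'a
  have "((\<lambda>e. cinner (adj_op A e) (\<Phi> (ketbra x x) (adj_op A e))) has_sum n) ?E"
    using trace_conjugation[OF qo_ketbra_self(1,2) b, of x] constant_diagonal[OF AA, of x] n
    by (simp add: cinner_adj_right)
  then have pp: "((\<lambda>e. qo_kernel (p e) (p e)) has_sum n) ?E"
    by (simp add: p_def qo_kernel_minus_left qo_kernel_minus_right) (simp add: qo_kernel_def)
  have "((\<lambda>e. cinner e (A (\<Phi> (ketbra x (A x)) e))) has_sum n) ?E"
    using trace_span_has_sum(2)[OF qo_ketbra_in_trace_span b, of x "A x"] constant_off_diagonal[OF A] n by simp
  from has_sum_uminusI[OF this] have pq: "((\<lambda>e. qo_kernel (p e) (q e)) has_sum - n) ?E"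
    by (simp add: p_def q_def qo_kernel_minus_left) (simp add: qo_kernel_def cinner_adj_left)
  have "((\<lambda>e. cinner e (\<Phi> (ketbra (A x) x) (adj_op A e))) has_sum n) ?E"
    using trace_span_has_sum(1)[OF qo_ketbra_in_trace_span adj_op_bounded[OF b], of "A x" x]
      constant_off_diagonal[OF constants_adj[OF A]] n by (simp add: cinner_adj_right)
  from has_sum_uminusI[OF this] have qp: "((\<lambda>e. qo_kernel (q e) (p e)) has_sum - n) ?E"
    by (simp add: p_def q_def qo_kernel_minus_right) (simp add: qo_kernel_def)
  have qq: "((\<lambda>e. qo_kernel (q e) (q e)) has_sum n) ?E"
    using trace_has_sum[OF qo_ketbra_self(1,2), of "A x"]
    by (simp add: q_def qo_kernel_def qo_ketbra_self(3) n_def)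
  let ?d = "\<lambda>e. qo_kernel (p e) (p e) + qo_kernel (p e) (q e) + qo_kernel (q e) (p e) + qo_kernel (q e) (q e)"
  have "(?d has_sum (n + - n + - n + n)) ?E"
    by (intro has_sum_add pp pq qp qq)
  then have sum0: "((\<lambda>e. Re (?d e)) has_sum 0) ?E"
    using has_sum_Re[of ?d] by fastforce
  have null: "Re (?d e) = 0" if "e \<in> ?E" for e
    by (rule nonneg_has_sum_le_0D[OF sum0 _ _ that])
      (use qo_kernel_pair_positive complex_nonneg_Reals_iff in blast)+
  have "\<Phi> (ketbra (A x) u) v - A (\<Phi> (ketbra x u) v) = 0"
  proof (rule some_onb_total)
    fix e assume "e \<in> ?E"
    then have "(cmod (qo_kernel (p e) (v, u) + qo_kernel (q e) (v, u)))\<^sup>2 \<le> 0"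
      using qo_kernel_Cauchy_Schwarz[of "p e" "(v, u)" "q e"] null by (metis mult_zero_left)
    then have "qo_kernel (p e) (v, u) + qo_kernel (q e) (v, u) = 0"
      by simp
    then show "cinner e (\<Phi> (ketbra (A x) u) v - A (\<Phi> (ketbra x u) v)) = 0"
      by (simp add: p_def q_def qo_kernel_minus_left)
        (simp add: qo_kernel_def cinner_adj_left cinner_diff_right)
  qed
  then show "(A o\<^sub>L kraus u v) x = (kraus u v o\<^sub>L A) x"
    by simp
qed

definition kraus_ops :: "'a operator set" where
  "kraus_ops = {K. \<exists>u v. K = kraus u v \<or> K = adj_op (kraus u v)}"

lemma kraus_ops_bounded: "kraus_ops \<subseteq> bounded_ops"
  by (auto simp: kraus_ops_def)

lemma kraus_ops_adj: "K \<in> kraus_ops \<Longrightarrow> adj_op K \<in> kraus_ops"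
  unfolding kraus_ops_def using adj_adj[OF kraus_bounded] by fastforce

text \<open>Commutation with \<open>kraus x v\<close> for all \<open>v\<close> says \<open>\<Phi>(|A x\<rangle>\<langle>x|) = A \<Phi>(|x\<rangle>\<langle>x|)\<close>. Since
  \<open>\<Phi>\<close> preserves the trace, the trace of the left-hand side is \<open>\<langle>x, A x\<rangle>\<close>.\<close>

lemma commutant_kraus_constants:
  assumes "A \<in> commutant kraus_ops"
  shows "A \<in> constants \<Phi>"
proof (rule constantI)
  show b: "A \<in> bounded_ops"
    using assms by (simp add: commutant_def)
  fix x
  have "kraus x v o\<^sub>L A = A o\<^sub>L kraus x v" for v
    using assms by (auto simp: commutant_def kraus_ops_def)
  then have "kraus x v (A x) = A (kraus x v x)" for v
    by (metis blinfun_apply_blinfun_compose)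
  then have "\<Phi> (ketbra (A x) x) = A o\<^sub>L \<Phi> (ketbra x x)"
    by (intro blinfun_eqI) simp
  then have "op_trace (\<Phi> (ketbra x x) o\<^sub>L A) = op_trace (\<Phi> (ketbra (A x) x))"
    using trace_commute[OF qo_ketbra_in_trace_span b] by simp
  also have "\<dots> = cinner x (A x)"
    by (simp add: qo_trace trace_ketbra)
  finally show "op_trace (\<Phi> (ketbra x x) o\<^sub>L A) = cinner x (A x)" .
qed

end

section \<open>Commutants and polynomials\<close>

lemma commutant_triple:
  assumes "S \<subseteq> bounded_ops"
  shows "commutant (commutant (commutant S)) = commutant S"
  using assms unfolding commutant_def by auto

lemma closed_commutant: "closed (commutant M)"
proof -
  have eq: "commutant M = bounded_ops \<inter> (\<Inter>A\<in>M. {B. A o\<^sub>L B = B o\<^sub>L A})"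
    by (auto simp: commutant_def)
  have cl: "closed {B. A o\<^sub>L B = B o\<^sub>L A}" for A :: "'a operator"
    by (intro closed_Collect_eq linear_continuous_on
        bounded_bilinear.bounded_linear_left[OF bounded_bilinear_blinfun_compose]
        bounded_bilinear.bounded_linear_right[OF bounded_bilinear_blinfun_compose])
  show ?thesis
    unfolding eq by (intro closed_Int closed_bounded_ops closed_INT ballI cl)
qed

lemma commute_apply: "A o\<^sub>L B = B o\<^sub>L A \<Longrightarrow> A (B x) = B (A x)"
  by (metis blinfun_apply_blinfun_compose)

lemma star_algebra_commutant:
  fixes S :: "'a::chilbert_space operator set"
  assumes S: "S \<subseteq> bounded_ops" and adj: "\<And>A. A \<in> S \<Longrightarrow> adj_op A \<in> S"
  shows "star_algebra (commutant S)"
  unfolding star_algebra_def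
proof (intro conjI ballI allI)
  have comm: "A (B x) = B (A x)" if "A \<in> S" "B \<in> commutant S" for A B x
    using that by (intro commute_apply) (auto simp: commutant_def)
  have lin: "A (c *\<^sub>C x) = c *\<^sub>C A x" if "A \<in> S" for A c x
    using S that by (auto intro: bounded_opsD)
  show "commutant S \<subseteq> bounded_ops" "0 \<in> commutant S"
    by (auto simp: commutant_def)
  fix B C assume B: "B \<in> commutant S" and C: "C \<in> commutant S"
  have b: "B \<in> bounded_ops" "C \<in> bounded_ops"
    using B C by (auto simp: commutant_def)
  show "B + C \<in> commutant S" "B o\<^sub>L C \<in> commutant S"
    using b comm[OF _ B] comm[OF _ C]
    by (auto simp: commutant_def blinfun.add_left blinfun.add_right intro!: blinfun_eqI)
next
  fix c B assume B: "B \<in> commutant S"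
  show "scaleC_op c B \<in> commutant S"
  proof -
    have "A o\<^sub>L scaleC_op c B = scaleC_op c B o\<^sub>L A" if "A \<in> S" for A
    proof (rule blinfun_eqI)
      fix x
      have "A (B x) = B (A x)" "A \<in> bounded_ops"
        using that B S by (auto simp: commutant_def intro: commute_apply)
      then show "(A o\<^sub>L scaleC_op c B) x = (scaleC_op c B o\<^sub>L A) x"
        by (simp add: bounded_opsD)
    qed
    then show ?thesis
      using B by (auto simp: commutant_def)
  qed
next
  fix B assume B: "B \<in> commutant S"
  then have b: "B \<in> bounded_ops"
    by (auto simp: commutant_def)
  have "A o\<^sub>L adj_op B = adj_op B o\<^sub>L A" if "A \<in> S" for A
  proof -
    have a: "A \<in> bounded_ops"
      using that S by auto
    have "adj_op A o\<^sub>L B = B o\<^sub>L adj_op A"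
      using adj[OF that] B by (auto simp: commutant_def)
    then have "adj_op (adj_op A o\<^sub>L B) = adj_op (B o\<^sub>L adj_op A)"
      by simp
    then show ?thesis
      using a b by (simp add: adj_compose)
  qed
  then show "adj_op B \<in> commutant S"
    using b by (auto simp: commutant_def)
qed

lemma von_neumann_algebra_commutant:
  assumes "S \<subseteq> bounded_ops" "\<And>A. A \<in> S \<Longrightarrow> adj_op A \<in> S"
  shows "von_neumann_algebra (commutant S)"
  using star_algebra_commutant[OF assms] commutant_triple[OF assms(1)]
  by (simp add: von_neumann_algebra_def)

lemma von_neumann_algebra_id: "von_neumann_algebra M \<Longrightarrow> id_blinfun \<in> M"
proof -
  have "id_blinfun \<in> commutant (commutant M)"
    by (auto simp: commutant_def intro!: blinfun_eqI)
  then show "von_neumann_algebra M \<Longrightarrow> id_blinfun \<in> M"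
    by (simp add: von_neumann_algebra_def)
qed

lemma von_neumann_algebra_cstar: "von_neumann_algebra M \<Longrightarrow> cstar_algebra M"
  unfolding von_neumann_algebra_def cstar_algebra_def using closed_commutant by metis

lemma star_algebra_eval_word:
  "star_algebra M \<Longrightarrow> id_blinfun \<in> M \<Longrightarrow> A \<in> M \<Longrightarrow> B \<in> M \<Longrightarrow> eval_word A B w \<in> M"
  by (induction A B w rule: eval_word.induct) (auto simp: star_algebra_def)

lemma star_algebra_eval_nc_poly:
  assumes M: "star_algebra M" "id_blinfun \<in> M" "A \<in> M"
  shows "eval_nc_poly p A (adj_op A) \<in> M"
proof -
  have "(\<Sum>w\<in>W. scaleC_op (Poly_Mapping.lookup p w) (eval_word A (adj_op A) w)) \<in> M" if "finite W" for W
    using that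
  proof (induction W)
    case (insert w W)
    have "eval_word A (adj_op A) w \<in> M"
      using M by (intro star_algebra_eval_word) (auto simp: star_algebra_def)
    then show ?case
      using insert M(1) by (simp add: star_algebra_def)
  qed (use M in \<open>simp add: star_algebra_def\<close>)
  then show ?thesis
    by (simp add: eval_nc_poly_def)
qed

lemma eval_nc_poly_word: "eval_nc_poly (Poly_Mapping.single w 1) A B = eval_word A B w"
  by (simp add: eval_nc_poly_def) (rule blinfun_eqI, simp)


section \<open>The four sets of constants\<close>

text \<open>One inclusion applies \<open>kraus_commute\<close> to \<open>A\<close> and to its adjoint; this is where
  \<open>A A\<^sup>*\<close> must be a constant. For the other, the commutant is a *-algebra of constants, so it
  contains \<open>A\<^sup>* A\<close> and \<open>A A\<^sup>*\<close> along with \<open>A\<close>.\<close>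

lemma constants_2_eq_commutant:
  assumes qo: "quantum_operation \<Phi>"
  shows "constants_2 \<Phi> = commutant (kraus_ops \<Phi>)"
proof (intro equalityI subsetI)
  fix A assume A: "A \<in> constants_2 \<Phi>"
  then have b [simp]: "A \<in> bounded_ops" and c: "A \<in> constants \<Phi>" "adj_op A o\<^sub>L A \<in> constants \<Phi>"
      "A o\<^sub>L adj_op A \<in> constants \<Phi>"
    by (auto simp: constants_2_def)
  have "A o\<^sub>L adj_op (kraus \<Phi> u v) = adj_op (kraus \<Phi> u v) o\<^sub>L A" for u v
  proof -
    have "adj_op A o\<^sub>L kraus \<Phi> u v = kraus \<Phi> u v o\<^sub>L adj_op A"
      using c by (intro kraus_commute[OF qo] constants_adj[OF qo]) auto
    then have "adj_op (adj_op A o\<^sub>L kraus \<Phi> u v) = adj_op (kraus \<Phi> u v o\<^sub>L adj_op A)"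
      by simp
    then show ?thesis
      using kraus_bounded[OF qo, of u v] by (simp add: adj_compose)
  qed
  then show "A \<in> commutant (kraus_ops \<Phi>)"
    using kraus_commute[OF qo c(1,2)] by (auto simp: commutant_def kraus_ops_def[OF qo])
next
  fix A assume A: "A \<in> commutant (kraus_ops \<Phi>)"
  have "star_algebra (commutant (kraus_ops \<Phi>))"
    by (intro star_algebra_commutant kraus_ops_bounded kraus_ops_adj qo)
  then have "adj_op A o\<^sub>L A \<in> commutant (kraus_ops \<Phi>)" "A o\<^sub>L adj_op A \<in> commutant (kraus_ops \<Phi>)"
    using A by (auto simp: star_algebra_def)
  then show "A \<in> constants_2 \<Phi>"
    using A commutant_kraus_constants[OF qo] by (auto simp: constants_2_def commutant_def)
qed

lemma constants_2_subset_w: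
  assumes qo: "quantum_operation \<Phi>"
  shows "constants_2 \<Phi> \<subseteq> constants_w \<Phi>"
proof
  fix A assume A: "A \<in> constants_2 \<Phi>"
  have "von_neumann_algebra (constants_2 \<Phi>)"
    unfolding constants_2_eq_commutant[OF qo]
    by (intro von_neumann_algebra_commutant kraus_ops_bounded kraus_ops_adj qo)
  then have "von_neumann_algebra hull {A} \<subseteq> constants_2 \<Phi>"
    using A by (intro hull_minimal) auto
  then show "A \<in> constants_w \<Phi>"
    using A by (auto simp: constants_w_def constants_2_def)
qed

lemma constants_w_subset_c: "constants_w \<Phi> \<subseteq> constants_c \<Phi>"
proof
  fix A assume A: "A \<in> constants_w \<Phi>"
  have "cstar_algebra hull {id_blinfun, A} \<subseteq> von_neumann_algebra hull {A}"
    unfolding hull_def using von_neumann_algebra_id von_neumann_algebra_cstar by blast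
  then show "A \<in> constants_c \<Phi>"
    using A by (auto simp: constants_w_def constants_c_def)
qed

lemma constants_c_subset_p: "constants_c \<Phi> \<subseteq> constants_p \<Phi>"
proof
  fix A assume A: "A \<in> constants_c \<Phi>"
  have "eval_nc_poly p A (adj_op A) \<in> cstar_algebra hull {id_blinfun, A}" for p
    unfolding hull_def by (auto simp: cstar_algebra_def intro: star_algebra_eval_nc_poly)
  then show "A \<in> constants_p \<Phi>"
    using A by (auto simp: constants_p_def constants_c_def)
qed

lemma constants_p_subset_2: "constants_p \<Phi> \<subseteq> constants_2 \<Phi>"
proof
  fix A assume A: "A \<in> constants_p \<Phi>"
  have "eval_word A (adj_op A) w \<in> constants \<Phi>" for w
    unfolding eval_nc_poly_word[symmetric] using A by (simp add: constants_p_def)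
  from this[of "[Var1]"] this[of "[Var2, Var1]"] this[of "[Var1, Var2]"]
  have "A o\<^sub>L id_blinfun \<in> constants \<Phi>" "adj_op A o\<^sub>L (A o\<^sub>L id_blinfun) \<in> constants \<Phi>"
    "A o\<^sub>L (adj_op A o\<^sub>L id_blinfun) \<in> constants \<Phi>"
    by simp_all
  moreover have "B o\<^sub>L id_blinfun = B" for B :: "'a operator"
    by (rule blinfun_eqI) simp
  ultimately show "A \<in> constants_2 \<Phi>"
    using A by (simp add: constants_2_def constants_p_def)
qed

lemma constants_all_equal:
  assumes "quantum_operation \<Phi>"
  shows "constants_p \<Phi> = constants_2 \<Phi>" "constants_c \<Phi> = constants_2 \<Phi>" "constants_w \<Phi> = constants_2 \<Phi>"
  using constants_2_subset_w[OF assms] constants_w_subset_c[of \<Phi>] constants_c_subset_p[of \<Phi>]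
    constants_p_subset_2[of \<Phi>] by auto

lemma sys_constants_Inter: "sys_constants \<Psi> = (\<Inter>t\<in>{0..}. constants (\<Psi> t))"
  by (auto simp: sys_constants_def constants_def)

text \<open>The intersection of the commutants is the commutant of the union of the Kraus operators at all
  times.\<close>

lemma von_neumann_algebra_sys_constants_2:
  assumes qo: "\<And>t. 0 \<le> t \<Longrightarrow> quantum_operation (\<Psi> t)"
  shows "von_neumann_algebra (sys_constants_2 \<Psi>)"
proof -
  let ?S = "\<Union>t\<in>{0..}. kraus_ops (\<Psi> t)"
  have "sys_constants_2 \<Psi> = (\<Inter>t\<in>{0..}. commutant (kraus_ops (\<Psi> t)))"
    unfolding sys_constants_2_def using constants_2_eq_commutant[OF qo] by auto
  also have "\<dots> = commutant ?S"
    by (auto simp: commutant_def)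
  finally have "sys_constants_2 \<Psi> = commutant ?S" .
  moreover have "von_neumann_algebra (commutant ?S)"
    using kraus_ops_bounded[OF qo] kraus_ops_adj[OF qo]
    by (intro von_neumann_algebra_commutant) fastforce+
  ultimately show ?thesis by simp
qed

section \<open>Constants of dynamical quantum systems\<close>

theorem theorem5p8:
  fixes \<Psi> :: "real \<Rightarrow> 'a::chilbert_space operator \<Rightarrow> 'a operator"
  assumes "dynamical_quantum_system \<Psi>"
  shows "(sys_constants_2 \<Psi> = sys_constants_p \<Psi> \<and>
          sys_constants_p \<Psi> = sys_constants_c \<Psi> \<and>
          sys_constants_c \<Psi> = sys_constants_w \<Psi> \<and>
          von_neumann_algebra (sys_constants_2 \<Psi>)) \<and>
         ((\<forall>A\<in>sys_constants \<Psi>. \<forall>B\<in>sys_constants \<Psi>. A o\<^sub>L B \<in> sys_constants \<Psi>)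
            \<longleftrightarrow> sys_constants \<Psi> = sys_constants_2 \<Psi>) \<and>
         (sys_constants \<Psi> = sys_constants_2 \<Psi> \<longleftrightarrow> cstar_algebra (sys_constants \<Psi>)) \<and>
         (cstar_algebra (sys_constants \<Psi>) \<longleftrightarrow> von_neumann_algebra (sys_constants \<Psi>))"
proof -
  have qo: "quantum_operation (\<Psi> t)" if "0 \<le> t" for t
    using assms that by (simp add: dynamical_quantum_system_def)
  have a: "sys_constants_p \<Psi> = sys_constants_2 \<Psi>" "sys_constants_c \<Psi> = sys_constants_2 \<Psi>"
      "sys_constants_w \<Psi> = sys_constants_2 \<Psi>"
    using constants_all_equal[OF qo]
    by (auto simp: sys_constants_2_def sys_constants_p_def sys_constants_c_def sys_constants_w_def)
  have vN: "von_neumann_algebra (sys_constants_2 \<Psi>)"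
    by (rule von_neumann_algebra_sys_constants_2[OF qo])
  have sub: "sys_constants_2 \<Psi> \<subseteq> sys_constants \<Psi>"
    by (auto simp: sys_constants_Inter sys_constants_2_def constants_2_def)
  define mult where
    "mult \<longleftrightarrow> (\<forall>A\<in>sys_constants \<Psi>. \<forall>B\<in>sys_constants \<Psi>. A o\<^sub>L B \<in> sys_constants \<Psi>)"
  have mult_imp: "sys_constants \<Psi> = sys_constants_2 \<Psi>" if mult
  proof (intro equalityI sub subsetI)
    fix A assume A: "A \<in> sys_constants \<Psi>"
    then have "adj_op A \<in> sys_constants \<Psi>"
      using constants_adj[OF qo] by (auto simp: sys_constants_Inter)
    then have "adj_op A o\<^sub>L A \<in> sys_constants \<Psi>" "A o\<^sub>L adj_op A \<in> sys_constants \<Psi>"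
      using that A by (auto simp: mult_def)
    then show "A \<in> sys_constants_2 \<Psi>"
      using A by (auto simp: sys_constants_Inter sys_constants_2_def constants_2_def constants_def)
  qed
  have star_imp: mult if "star_algebra (sys_constants \<Psi>)"
    using that by (simp add: mult_def star_algebra_def)
  have cstar_imp: "star_algebra M" if "cstar_algebra M" for M :: "'a operator set"
    using that by (simp add: cstar_algebra_def)
  have "mult \<longleftrightarrow> sys_constants \<Psi> = sys_constants_2 \<Psi>"
    and "sys_constants \<Psi> = sys_constants_2 \<Psi> \<longleftrightarrow> cstar_algebra (sys_constants \<Psi>)"
    and "cstar_algebra (sys_constants \<Psi>) \<longleftrightarrow> von_neumann_algebra (sys_constants \<Psi>)"
    using mult_imp star_imp cstar_imp vN von_neumann_algebra_cstar by metis+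
  then show ?thesis
    using a vN unfolding mult_def by simp
qed

end
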